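(* Assume that the unperturbed system $\dot x=X^0(x)$ on $\mathscr{M}$ has a $T$-periodic orbit $\gamma(t)$ for some constant $T>0$, and that it has a $C^3$ commutative vector field $Z$ (i.e. $[X^0,Z]=0$) near $\Gamma=\{\gamma(t)\mid t\in[0,T)\}$ which is linearly independent of $X^0$. If the perturbed system $\dot x=X_\varepsilon(x)$ has a $T_\varepsilon$-periodic orbit $\gamma_\varepsilon$ depending $C^2$-smoothly on $\varepsilon$ such that $T_0=T$ and $\gamma_0=\gamma$, then $$\mathscr{J}_{\omega,Z,\gamma}:=\int_0^T\omega([X^1,Z])(\gamma(t))\,dt=0$$ for some nontrivial section $\omega$ of $T^*_\Gamma$ satisfying the adjoint variational equation of $X^0$ along $\Gamma$.
   Context: $\mathscr{M}$ is an $n$-dimensional ($n\ge2$) paracompact oriented $C^4$ real manifold. $\varepsilon$ is a small parameter, $0\le\varepsilon\ll1$, and $X_\varepsilon$ is a family of vector fields on $\mathscr{M}$ that is $C^3$ with respect to $x$ and $\varepsilon$, with $X_\varepsilon(x)=X^0(x)+\varepsilon X^1(x)+O(\varepsilon^2)$. $[\cdot,\cdot]$ is the Lie bracket of vector fields. The periodic orbit $\gamma$ is a non-stationary solution. Adjoint variational equation (AVE): let $X$ be a vector field on $\mathscr{M}$ and $\Gamma_\phi$ an integral curve given by a non-stationary solution $x=\phi(t)$ of $\dot x=X(x)$, with immersion $i:\Gamma_\phi\to\mathscr{M}$. Put $T_{\Gamma_\phi}=i^*T\mathscr{M}$ and let $T^*_{\Gamma_\phi}$ be its dual bundle. A $C^1$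 section $\alpha$ of $T^*_{\Gamma_\phi}$ satisfies the AVE of $X$ along $\Gamma_\phi$ if $\nabla^*\alpha:=dt\otimes\mathcal{L}_X\tilde\alpha|_{\Gamma_\phi}=0$, where $\tilde\alpha$ is any $C^1$ differential 1-form extending $\alpha$ and $\mathcal{L}_X$ is the Lie derivative. In local coordinates, with $\alpha=\sum_j\eta_j\,dx_j$, this reads $\dot\eta=-\left(\frac{\partial X}{\partial x}(\phi(t))\right)^{\mathrm T}\eta$. A section over the closed curve $\Gamma$ corresponds to a periodic solution. *)

theory Defs
  imports "HOL-Analysis.Analysis"
begin

text \<open>
  Functions of class \<open>C\<^sup>k\<close> on a set. Derivatives are taken within \<open>S\<close>, so that a closed end of a
  parameter interval \<open>{0..<e}\<close> is treated by one-sided derivatives; for open \<open>S\<close> this is the usual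
  notion. It is only meant for sets in which derivatives within the set are unique, such as open
  sets, relatively open subsets of \<open>{0..<e}\<close>, and products of these.
\<close>

primrec Ck :: "nat \<Rightarrow> ('a::euclidean_space \<Rightarrow> 'b::real_normed_vector) \<Rightarrow> 'a set \<Rightarrow> bool" where
  "Ck 0 f S \<longleftrightarrow> continuous_on S f"
| "Ck (Suc k) f S \<longleftrightarrow>
     (\<exists>f'. (\<forall>x\<in>S. (f has_derivative f' x) (at x within S)) \<and> (\<forall>v. Ck k (\<lambda>x. f' x v) S))"

definition paracompact_space :: "'a topology \<Rightarrow> bool" where
  "paracompact_space X \<longleftrightarrow>
     (\<forall>\<U>. (\<forall>U\<in>\<U>. openin X U) \<and> \<Union>\<U> = topspace X \<longrightarrow>
        (\<exists>\<V>. (\<forall>V\<in>\<V>. openin X V \<and> (\<exists>U\<in>\<U>. V \<subseteq> U)) \<and> \<Union>\<V> = topspace X \<and> locally_finite_in X \<V>))"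


section \<open>Oriented manifolds\<close>

text \<open>
  The underlying space of a manifold is a whole (Hausdorff) type \<open>'m\<close>. A chart is a pair of its domain
  and its coordinate map; the values of the coordinate map outside the domain are irrelevant.
\<close>

type_synonym ('m, 'n) chart = "'m set \<times> ('m \<Rightarrow> real ^ 'n)"

abbreviation cdom :: "('m, 'n) chart \<Rightarrow> 'm set" where "cdom c \<equiv> fst c"
abbreviation cmap :: "('m, 'n) chart \<Rightarrow> 'm \<Rightarrow> real ^ 'n" where "cmap c \<equiv> snd c"

definition cinv :: "('m, 'n) chart \<Rightarrow> real ^ 'n \<Rightarrow> 'm" where
  "cinv c = inv_into (cdom c) (cmap c)"

definition transition :: "('m, 'n) chart \<Rightarrow> ('m, 'n) chart \<Rightarrow> real ^ 'n \<Rightarrow> real ^ 'n" where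
  "transition c c' = cmap c' \<circ> cinv c"

text \<open>The derivative of the coordinate change from \<open>c\<close> to \<open>c'\<close> at the point \<open>p\<close>.\<close>

definition dtransition ::
    "('m, 'n::finite) chart \<Rightarrow> ('m, 'n) chart \<Rightarrow> 'm \<Rightarrow> real ^ 'n \<Rightarrow> real ^ 'n" where
  "dtransition c c' p = frechet_derivative (transition c c') (at (cmap c p))"

text \<open>
  The atlas need not be maximal; all notions below are invariant under passing to a compatible
  oriented atlas. The orientation is the one for which all charts of the atlas are positive.
\<close>

definition oriented_manifold :: "nat \<Rightarrow> ('m::t2_space, 'n::finite) chart set \<Rightarrow> bool" where
  "oriented_manifold k A \<longleftrightarrow>
     (\<Union>c\<in>A. cdom c) = UNIV \<and>
     (\<forall>c\<in>A. open (cdom c) \<and> open (cmap c ` cdom c) \<and>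
        homeomorphism (cdom c) (cmap c ` cdom c) (cmap c) (cinv c)) \<and>
     (\<forall>c\<in>A. \<forall>c'\<in>A. Ck k (transition c c') (cmap c ` (cdom c \<inter> cdom c')) \<and>
        (\<forall>p\<in>cdom c \<inter> cdom c'. det (matrix (dtransition c c' p)) > 0))"


section \<open>Vector fields and 1-forms\<close>

text \<open>
  Vector fields and 1-forms are families of components, indexed by charts, which transform by the
  Jacobian of the coordinate changes and by its transpose, respectively: \<open>F c p\<close> is the coordinate
  vector in the chart \<open>c\<close> of the (co)vector at \<open>p\<close>, and is only relevant for charts \<open>c\<close> around \<open>p\<close>.
  (On a manifold of finite differentiability class the space of derivations at a point is too big
  to serve as tangent space.)
\<close>

type_synonym ('m, 'n) field = "('m, 'n) chart \<Rightarrow> 'm \<Rightarrow> real ^ 'n"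

definition vector_field_on :: "('m, 'n::finite) chart set \<Rightarrow> 'm set \<Rightarrow> ('m, 'n) field \<Rightarrow> bool" where
  "vector_field_on A U X \<longleftrightarrow>
     (\<forall>c\<in>A. \<forall>c'\<in>A. \<forall>p\<in>cdom c \<inter> cdom c' \<inter> U. X c' p = dtransition c c' p (X c p))"

definition one_form_on :: "('m, 'n::finite) chart set \<Rightarrow> 'm set \<Rightarrow> ('m, 'n) field \<Rightarrow> bool" where
  "one_form_on A U \<alpha> \<longleftrightarrow>
     (\<forall>c\<in>A. \<forall>c'\<in>A. \<forall>p\<in>cdom c \<inter> cdom c' \<inter> U. \<alpha> c p = adjoint (dtransition c c' p) (\<alpha> c' p))"

definition local_rep :: "('m, 'n) field \<Rightarrow> ('m, 'n) chart \<Rightarrow> real ^ 'n \<Rightarrow> real ^ 'n" where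
  "local_rep F c = (\<lambda>x. F c (cinv c x))"

definition Ck_field_on ::
    "('m, 'n::finite) chart set \<Rightarrow> nat \<Rightarrow> 'm set \<Rightarrow> ('m, 'n) field \<Rightarrow> bool" where
  "Ck_field_on A k U F \<longleftrightarrow> (\<forall>c\<in>A. Ck k (local_rep F c) (cmap c ` (cdom c \<inter> U)))"

text \<open>The derivative of the components of \<open>F\<close> in the chart \<open>c\<close>, at \<open>p\<close> in direction \<open>v\<close>.\<close>

definition dfield ::
    "('m, 'n::finite) field \<Rightarrow> ('m, 'n) chart \<Rightarrow> 'm \<Rightarrow> real ^ 'n \<Rightarrow> real ^ 'n" where
  "dfield F c p = frechet_derivative (local_rep F c) (at (cmap c p))"

definition lie_bracket :: "('m, 'n::finite) field \<Rightarrow> ('m, 'n) field \<Rightarrow> ('m, 'n) field" where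
  "lie_bracket X Y = (\<lambda>c p. dfield Y c p (X c p) - dfield X c p (Y c p))"

text \<open>
  The Lie derivative of a 1-form:
  \<open>(L\<^sub>X \<alpha>)\<^sub>i = \<Sum>\<^sub>j (X\<^sub>j \<partial>\<^sub>j \<alpha>\<^sub>i + \<alpha>\<^sub>j \<partial>\<^sub>i X\<^sub>j)\<close>.
\<close>

definition lie_derivative_form :: "('m, 'n::finite) field \<Rightarrow> ('m, 'n) field \<Rightarrow> ('m, 'n) field" where
  "lie_derivative_form X \<alpha> = (\<lambda>c p. dfield \<alpha> c p (X c p) + adjoint (dfield X c p) (\<alpha> c p))"

text \<open>The value \<open>\<alpha>(X)(p)\<close>; by the transformation rules the choice of the chart does not matter.\<close>

definition form_apply ::
    "('m, 'n::finite) chart set \<Rightarrow> ('m, 'n) field \<Rightarrow> ('m, 'n) field \<Rightarrow> 'm \<Rightarrow> real" where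
  "form_apply A \<alpha> X p = (let c = (SOME c. c \<in> A \<and> p \<in> cdom c) in \<alpha> c p \<bullet> X c p)"

text \<open>
  A family of vector fields \<open>X \<epsilon>\<close>, \<open>0 \<le> \<epsilon> < e\<close>, of class \<open>C\<^sup>k\<close> jointly in \<open>\<epsilon>\<close> and the point.
\<close>

definition Ck_vector_field_family ::
    "('m, 'n::finite) chart set \<Rightarrow> nat \<Rightarrow> real \<Rightarrow> (real \<Rightarrow> ('m, 'n) field) \<Rightarrow> bool" where
  "Ck_vector_field_family A k e X \<longleftrightarrow>
     (\<forall>\<epsilon>\<in>{0..<e}. vector_field_on A UNIV (X \<epsilon>)) \<and>
     (\<forall>c\<in>A. Ck k (\<lambda>(\<epsilon>, x). local_rep (X \<epsilon>) c x) ({0..<e} \<times> cmap c ` cdom c))"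


section \<open>Periodic orbits\<close>

definition Ck_into ::
    "('m::topological_space, 'n::finite) chart set \<Rightarrow> nat \<Rightarrow> ('a::euclidean_space \<Rightarrow> 'm) \<Rightarrow> 'a set \<Rightarrow> bool"
  where "Ck_into A k f S \<longleftrightarrow>
     continuous_on S f \<and> (\<forall>c\<in>A. Ck k (cmap c \<circ> f) {s \<in> S. f s \<in> cdom c})"

definition solution ::
    "('m::topological_space, 'n::finite) chart set \<Rightarrow> ('m, 'n) field \<Rightarrow> (real \<Rightarrow> 'm) \<Rightarrow> bool" where
  "solution A X \<phi> \<longleftrightarrow>
     continuous_on UNIV \<phi> \<and>
     (\<forall>t. \<forall>c\<in>A. \<phi> t \<in> cdom c \<longrightarrow>
        ((cmap c \<circ> \<phi>) has_vector_derivative X c (\<phi> t)) (at t))"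

text \<open>The period \<open>T\<close> is not required to be minimal.\<close>

definition periodic_orbit ::
    "('m::topological_space, 'n::finite) chart set \<Rightarrow> ('m, 'n) field \<Rightarrow> real \<Rightarrow> (real \<Rightarrow> 'm) \<Rightarrow> bool" where
  "periodic_orbit A X T \<phi> \<longleftrightarrow>
     T > 0 \<and> solution A X \<phi> \<and> (\<forall>t. \<phi> (t + T) = \<phi> t) \<and> (\<exists>t. \<phi> t \<noteq> \<phi> 0)"


section \<open>The adjoint variational equation\<close>

text \<open>
  Sections of the dual of the tangent bundle of the manifold, restricted to the orbit \<open>range \<phi>\<close>.
  They are functions of the point on the orbit, hence periodic along a periodic orbit;
  differentiability is along the orbit.
\<close>

definition C1_section ::
    "('m, 'n::finite) chart set \<Rightarrow> (real \<Rightarrow> 'm) \<Rightarrow> ('m, 'n) field \<Rightarrow> bool" where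
  "C1_section A \<phi> \<alpha> \<longleftrightarrow>
     one_form_on A (range \<phi>) \<alpha> \<and> (\<forall>c\<in>A. Ck 1 (\<lambda>t. \<alpha> c (\<phi> t)) {t. \<phi> t \<in> cdom c})"

definition C1_extension ::
    "('m::topological_space, 'n::finite) chart set \<Rightarrow> (real \<Rightarrow> 'm) \<Rightarrow> ('m, 'n) field \<Rightarrow>
      'm set \<Rightarrow> ('m, 'n) field \<Rightarrow> bool" where
  "C1_extension A \<phi> \<alpha> U \<alpha>' \<longleftrightarrow>
     open U \<and> one_form_on A U \<alpha>' \<and> Ck_field_on A 1 U \<alpha>' \<and>
     (\<forall>c\<in>A. \<forall>p\<in>cdom c \<inter> U \<inter> range \<phi>. \<alpha>' c p = \<alpha> c p)"

text \<open>
  The Lie derivative is local and its value on the orbit does not depend on the extension, so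
  extensions to open sets around the points of the orbit are used. The clause on the
  existence of extensions keeps the clause on arbitrary extensions from being vacuous.
\<close>

definition satisfies_AVE ::
    "('m::topological_space, 'n::finite) chart set \<Rightarrow> ('m, 'n) field \<Rightarrow> (real \<Rightarrow> 'm) \<Rightarrow>
      ('m, 'n) field \<Rightarrow> bool" where
  "satisfies_AVE A X \<phi> \<alpha> \<longleftrightarrow>
     C1_section A \<phi> \<alpha> \<and>
     (\<forall>p\<in>range \<phi>. \<exists>U \<alpha>'. p \<in> U \<and> C1_extension A \<phi> \<alpha> U \<alpha>') \<and>
     (\<forall>U \<alpha>'. C1_extension A \<phi> \<alpha> U \<alpha>' \<longrightarrow>
        (\<forall>c\<in>A. \<forall>p\<in>cdom c \<inter> U \<inter> range \<phi>. lie_derivative_form X \<alpha>' c p = 0))"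

end

theory Submission
  imports Defs
begin

text \<open>
  The theorem rests on a dimension count for the monodromy of the adjoint variational equation.

  Write \<open>\<tau>\<close> for the minimal period of the orbit and \<open>p = \<gamma> 0\<close>. Solving the adjoint variational
  equation of \<open>X0\<close> along \<open>\<gamma>\<close> over \<open>[0, \<tau>]\<close> gives a linear map \<open>M\<close> on the covectors at \<open>p\<close>, and
  \<open>\<xi>\<close> extends to a section over the closed curve exactly if \<open>M \<xi> = \<xi>\<close>. Along the orbit, the pairing of
  a solution with any vector field that commutes with \<open>X0\<close> is constant (\<open>pairing_constant\<close>). Both
  \<open>X0\<close> itself and \<open>Z\<close> are such fields, so \<open>M \<xi> - \<xi>\<close> annihilates the two linearly independent vectors
  \<open>X0 p\<close> and \<open>Z p\<close> for every \<open>\<xi>\<close>. Thus the image of \<open>M - 1\<close> has codimension at least two, and the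
  space of sections satisfying the equation has dimension at least two. The integral of
  \<open>\<omega>([X1, Z])\<close> over a period is a linear functional of \<open>\<omega>\<close>; on a space of dimension at least two it
  has a nontrivial zero (\<open>common_kernel_vector\<close>, \<open>AVE_section_in_kernel\<close>). The minimal period
  is the right one because a section is a function of the point of the orbit; the given period \<open>T\<close> is
  a multiple of it, and the integral over \<open>[0, T]\<close> is the corresponding multiple of the integral over
  \<open>[0, \<tau>]\<close>.

  What remains is to give a meaning to these words on a manifold of finite smoothness.
  \<^item> The Lie bracket and the adjoint variational equation must not depend on the chart. Both facts come
    from the symmetry of the second derivative of the coordinate changes (\<open>lie_bracket_transition\<close>,
    \<open>adjoint_equation_transition\<close>).
  \<^item> Solutions of the equation must exist over a whole period. In one chart this is a linear equation
    with continuous coefficients (\<open>linear_ode_exists\<close>); the pieces are glued along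
    the orbit (\<open>adjoint_solution_exists\<close>).
  \<^item> The parameters at which the orbit visits a given point must form a coset of \<open>\<int>\<tau>\<close>, which follows
    from uniqueness for \<open>X0\<close> (\<open>curve_meets_itself\<close>, \<open>minimal_period\<close>).
  \<^item> A section must extend locally to a differential form of class \<open>C\<^sup>1\<close>. Since \<open>X0\<close> does not vanish on
    the orbit, time along the orbit is locally the restriction of a \<open>C\<^sup>1\<close> function
    (\<open>local_time_function\<close>, \<open>local_extension_exists\<close>).
  \<^item> The integrand must be continuous, so \<open>X1\<close> must be of class \<open>C\<^sup>1\<close>. It is, being the
    derivative of the family with respect to the parameter (\<open>Ck_family_coefficients\<close>).
\<close>

section \<open>Calculus\<close>

text \<open>
  Two applications of the mean value theorem to the second difference of \<open>g\<close> over a parallelogram,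
  first in direction \<open>u\<close> and then in direction \<open>v\<close>.
\<close>
lemma increment_square_eq_second_derivative:
  fixes g :: "'a::real_normed_vector \<Rightarrow> real"
  assumes g: "\<And>y. y \<in> S \<Longrightarrow> (g has_derivative g' y) (at y)"
    and Du: "\<And>y. y \<in> S \<Longrightarrow> ((\<lambda>z. g' z u) has_derivative D y) (at y)"
    and h: "h > 0"
    and S: "\<And>r s. 0 \<le> r \<Longrightarrow> r \<le> h \<Longrightarrow> 0 \<le> s \<Longrightarrow> s \<le> h \<Longrightarrow> x + r *\<^sub>R u + s *\<^sub>R v \<in> S"
  obtains r s where "0 < r" "r < h" "0 < s" "s < h"
    "g (x + h *\<^sub>R u + h *\<^sub>R v) - g (x + h *\<^sub>R u) - g (x + h *\<^sub>R v) + g x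
       = h * h * D (x + r *\<^sub>R u + s *\<^sub>R v) v"
proof -
  define \<phi> where "\<phi> = (\<lambda>r. g (x + r *\<^sub>R u + h *\<^sub>R v) - g (x + r *\<^sub>R u))"
  have "(\<phi> has_real_derivative (g' (x + r *\<^sub>R u + h *\<^sub>R v) u - g' (x + r *\<^sub>R u) u)) (at r)"
    if r: "0 \<le> r" "r \<le> h" for r
  proof -
    have a: "((\<lambda>r. x + r *\<^sub>R u + s *\<^sub>R v) has_derivative (\<lambda>k. k *\<^sub>R u)) (at r)" for s
      by (auto intro!: derivative_eq_intros)
    have b: "((\<lambda>r. g (x + r *\<^sub>R u + s *\<^sub>R v)) has_real_derivative g' (x + r *\<^sub>R u + s *\<^sub>R v) u) (at r)"
      if "0 \<le> s" "s \<le> h" for s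
    proof -
      have y: "x + r *\<^sub>R u + s *\<^sub>R v \<in> S" using S r that by auto
      have "((\<lambda>r. g (x + r *\<^sub>R u + s *\<^sub>R v)) has_derivative
              (\<lambda>k. g' (x + r *\<^sub>R u + s *\<^sub>R v) (k *\<^sub>R u))) (at r)"
        using has_derivative_compose[OF a g[OF y]] by simp
      moreover have "linear (g' (x + r *\<^sub>R u + s *\<^sub>R v))"
        using g[OF y] has_derivative_linear by blast
      ultimately show ?thesis
        by (simp add: has_field_derivative_def linear_scale mult_commute_abs)
    qed
    show ?thesis unfolding \<phi>_def
      using DERIV_diff[OF b[of h] b[of 0]] h by simp
  qed
  from MVT2[OF h this] obtain r where r: "0 < r" "r < h"
    and r': "\<phi> h - \<phi> 0 = h * (g' (x + r *\<^sub>R u + h *\<^sub>R v) u - g' (x + r *\<^sub>R u) u)"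
    by auto
  have "((\<lambda>s. g' (x + r *\<^sub>R u + s *\<^sub>R v) u) has_real_derivative D (x + r *\<^sub>R u + s *\<^sub>R v) v) (at s)"
    if s: "0 \<le> s" "s \<le> h" for s
  proof -
    have y: "x + r *\<^sub>R u + s *\<^sub>R v \<in> S" using S r s by auto
    have a: "((\<lambda>s. x + r *\<^sub>R u + s *\<^sub>R v) has_derivative (\<lambda>k. k *\<^sub>R v)) (at s)"
      by (auto intro!: derivative_eq_intros)
    have "((\<lambda>s. g' (x + r *\<^sub>R u + s *\<^sub>R v) u) has_derivative
              (\<lambda>k. D (x + r *\<^sub>R u + s *\<^sub>R v) (k *\<^sub>R v))) (at s)"
      using has_derivative_compose[OF a Du[OF y]] by simp
    moreover have "linear (D (x + r *\<^sub>R u + s *\<^sub>R v))"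
      using Du[OF y] has_derivative_linear by blast
    ultimately show ?thesis
      by (simp add: has_field_derivative_def linear_scale mult_commute_abs)
  qed
  from MVT2[OF h this] obtain s where s: "0 < s" "s < h"
    and s': "g' (x + r *\<^sub>R u + h *\<^sub>R v) u - g' (x + r *\<^sub>R u) u = h * D (x + r *\<^sub>R u + s *\<^sub>R v) v"
    by auto
  show ?thesis
  proof (rule that[OF r s])
    show "g (x + h *\<^sub>R u + h *\<^sub>R v) - g (x + h *\<^sub>R u) - g (x + h *\<^sub>R v) + g x
       = h * h * D (x + r *\<^sub>R u + s *\<^sub>R v) v"
      using r' s' by (simp add: \<phi>_def algebra_simps)
  qed
qed

text \<open>
  The second difference does not change when \<open>u\<close> and \<open>v\<close> are exchanged. Evaluated in the two possible
  orders it gives both mixed derivatives at points that tend to \<open>x\<close> with the size of the parallelogram,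
  so by continuity they agree at \<open>x\<close>.
\<close>
lemma second_derivative_symmetric:
  fixes f :: "'a::real_normed_vector \<Rightarrow> 'b::euclidean_space" and S :: "'a set"
    and D :: "'a \<Rightarrow> 'a \<Rightarrow> 'a \<Rightarrow> 'b"
  assumes S: "open S" "x \<in> S"
    and f: "\<And>y. y \<in> S \<Longrightarrow> (f has_derivative f' y) (at y)"
    and D: "\<And>v y. y \<in> S \<Longrightarrow> ((\<lambda>z. f' z v) has_derivative D v y) (at y)"
    and cont: "\<And>u v. continuous_on S (\<lambda>y. D v y u)"
  shows "D u x v = D v x u"
proof (rule euclidean_eqI)
  fix b :: 'b
  show "D u x v \<bullet> b = D v x u \<bullet> b"
  proof (rule ccontr)
    assume ne: "D u x v \<bullet> b \<noteq> D v x u \<bullet> b"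
    define e where "e = \<bar>D u x v \<bullet> b - D v x u \<bullet> b\<bar> / 2"
    have e: "e > 0" using ne by (simp add: e_def)
    have near: "\<exists>d>0. \<forall>y. dist y x < d \<longrightarrow> \<bar>D u y v \<bullet> b - D u x v \<bullet> b\<bar> < e" for u v
    proof -
      have "isCont (\<lambda>y. D u y v \<bullet> b) x"
        using cont[of u v] S continuous_on_eq_continuous_at by (auto intro!: continuous_intros)
      then show ?thesis
        using e unfolding continuous_at_eps_delta dist_real_def by blast
    qed
    obtain d1 where d1: "d1 > 0" "\<And>y. dist y x < d1 \<Longrightarrow> \<bar>D u y v \<bullet> b - D u x v \<bullet> b\<bar> < e"
      using near by blast
    obtain d2 where d2: "d2 > 0" "\<And>y. dist y x < d2 \<Longrightarrow> \<bar>D v y u \<bullet> b - D v x u \<bullet> b\<bar> < e"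
      using near by blast
    obtain d3 where d3: "d3 > 0" "\<And>y. dist y x < d3 \<Longrightarrow> y \<in> S"
      using S openE by (metis dist_commute mem_ball subsetD)
    define d where "d = Min {d1, d2, d3}"
    have d: "d > 0" "d \<le> d1" "d \<le> d2" "d \<le> d3" using d1 d2 d3 by (auto simp: d_def)
    define h where "h = d / (2 * (norm u + norm v + 1))"
    have pos: "norm u + norm v + 1 > 0"
      by (smt (verit) norm_ge_zero)
    have h: "h > 0" using d pos by (simp add: h_def)
    have small: "dist (x + r *\<^sub>R u + s *\<^sub>R v) x < d"
      if "0 \<le> r" "r \<le> h" "0 \<le> s" "s \<le> h" for r s
    proof -
      have "dist (x + r *\<^sub>R u + s *\<^sub>R v) x = norm (r *\<^sub>R u + s *\<^sub>R v)"
        by (simp add: dist_norm)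
      also have "\<dots> \<le> r * norm u + s * norm v"
        using norm_triangle_ineq[of "r *\<^sub>R u" "s *\<^sub>R v"] that by simp
      also have "\<dots> \<le> h * norm u + h * norm v"
        using that by (intro add_mono mult_right_mono) auto
      also have "\<dots> \<le> h * (norm u + norm v + 1)" using h by (simp add: algebra_simps)
      also have "\<dots> = d / 2" using pos by (simp add: h_def field_simps)
      also have "\<dots> < d" using d by simp
      finally show ?thesis .
    qed
    have fb: "((\<lambda>z. f z \<bullet> b) has_derivative (\<lambda>w. f' y w \<bullet> b)) (at y)" if "y \<in> S" for y
      using f[OF that] by (rule has_derivative_inner_left)
    have Db: "((\<lambda>z. f' z w \<bullet> b) has_derivative (\<lambda>k. D w y k \<bullet> b)) (at y)" if "y \<in> S" for y w
      using D[OF that] by (rule has_derivative_inner_left)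
    obtain r s where rs: "0 < r" "r < h" "0 < s" "s < h"
      "f (x + h *\<^sub>R u + h *\<^sub>R v) \<bullet> b - f (x + h *\<^sub>R u) \<bullet> b - f (x + h *\<^sub>R v) \<bullet> b + f x \<bullet> b
       = h * h * (D u (x + r *\<^sub>R u + s *\<^sub>R v) v \<bullet> b)"
    proof (rule increment_square_eq_second_derivative[OF fb Db h, where x = x and u = u and v = v])
      show "x + r *\<^sub>R u + s *\<^sub>R v \<in> S" if "0 \<le> r" "r \<le> h" "0 \<le> s" "s \<le> h" for r s
        using small[OF that] d by (intro d3(2)) linarith
    qed auto
    have small': "dist (x + r *\<^sub>R v + s *\<^sub>R u) x < d"
      if "0 \<le> r" "r \<le> h" "0 \<le> s" "s \<le> h" for r s
      using small[OF that(3,4,1,2)] by (simp add: algebra_simps)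
    obtain r' s' where rs': "0 < r'" "r' < h" "0 < s'" "s' < h"
      "f (x + h *\<^sub>R v + h *\<^sub>R u) \<bullet> b - f (x + h *\<^sub>R v) \<bullet> b - f (x + h *\<^sub>R u) \<bullet> b + f x \<bullet> b
       = h * h * (D v (x + r' *\<^sub>R v + s' *\<^sub>R u) u \<bullet> b)"
    proof (rule increment_square_eq_second_derivative[OF fb Db h, where x = x and u = v and v = u])
      show "x + r *\<^sub>R v + s *\<^sub>R u \<in> S" if "0 \<le> r" "r \<le> h" "0 \<le> s" "s \<le> h" for r s
        using small'[OF that] d by (intro d3(2)) linarith
    qed auto
    have "h * h * (D u (x + r *\<^sub>R u + s *\<^sub>R v) v \<bullet> b) = h * h * (D v (x + r' *\<^sub>R v + s' *\<^sub>R u) u \<bullet> b)"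
      unfolding rs(5)[symmetric] rs'(5)[symmetric] by (simp add: algebra_simps)
    then have "D u (x + r *\<^sub>R u + s *\<^sub>R v) v \<bullet> b = D v (x + r' *\<^sub>R v + s' *\<^sub>R u) u \<bullet> b"
      using h by simp
    moreover have "\<bar>D u (x + r *\<^sub>R u + s *\<^sub>R v) v \<bullet> b - D u x v \<bullet> b\<bar> < e"
      using d1(2) small[of r s] rs d by simp
    moreover have "\<bar>D v (x + r' *\<^sub>R v + s' *\<^sub>R u) u \<bullet> b - D v x u \<bullet> b\<bar> < e"
      using d2(2) small'[of r' s'] rs' d by simp
    ultimately have "\<bar>D u x v \<bullet> b - D v x u \<bullet> b\<bar> < 2 * e" by arith
    then show False by (simp add: e_def)
  qed
qed

lemma linear_eq_sum_Basis:
  fixes f :: "'a::euclidean_space \<Rightarrow> 'b::real_vector"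
  assumes "linear f"
  shows "f y = (\<Sum>b\<in>Basis. (y \<bullet> b) *\<^sub>R f b)"
proof -
  have "f y = f (\<Sum>b\<in>Basis. (y \<bullet> b) *\<^sub>R b)" by (simp add: euclidean_representation)
  then show ?thesis using assms by (simp add: linear_sum linear_scale)
qed

lemma adjoint_inner:
  fixes f :: "'a::euclidean_space \<Rightarrow> 'b::euclidean_space"
  assumes "linear f"
  shows "adjoint f y \<bullet> x = y \<bullet> f x"
  using adjoint_works[OF assms, of x y] by (simp add: inner_commute)

lemma adjoint_eq_sum_Basis:
  fixes f :: "'a::euclidean_space \<Rightarrow> 'b::euclidean_space"
  assumes "linear f"
  shows "adjoint f y = (\<Sum>b\<in>Basis. (f b \<bullet> y) *\<^sub>R b)"
proof -
  have "(\<Sum>b\<in>Basis. (f b \<bullet> y) *\<^sub>R b) = (\<Sum>b\<in>Basis. (adjoint f y \<bullet> b) *\<^sub>R b)"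
    using adjoint_inner[OF assms] by (simp add: inner_commute)
  then show ?thesis by (simp add: euclidean_representation)
qed

text \<open>
  The product rule for a family of linear maps whose differentiability is only known pointwise, that
  is, as a family of vectors \<open>B z v\<close> for fixed \<open>v\<close>; a basis reduces it to finitely many products.
\<close>
lemma has_derivative_linear_apply:
  fixes B :: "'c::real_normed_vector \<Rightarrow> 'a::euclidean_space \<Rightarrow> 'b::real_normed_vector"
  assumes x: "x \<in> S"
    and lin: "\<And>z. z \<in> S \<Longrightarrow> linear (B z)"
    and B: "\<And>v. ((\<lambda>z. B z v) has_derivative B' v) (at x within S)"
    and y: "(y has_derivative y') (at x within S)"
  shows "((\<lambda>z. B z (y z)) has_derivative
           (\<lambda>h. B x (y' h) + (\<Sum>b\<in>Basis. (y x \<bullet> b) *\<^sub>R B' b h))) (at x within S)"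
proof (rule has_derivative_transform[OF x])
  show "B z (y z) = (\<Sum>b\<in>Basis. (y z \<bullet> b) *\<^sub>R B z b)" if "z \<in> S" for z
    using linear_eq_sum_Basis[OF lin[OF that]] .
  have "((\<lambda>z. \<Sum>b\<in>Basis. (y z \<bullet> b) *\<^sub>R B z b) has_derivative
          (\<lambda>h. \<Sum>b\<in>Basis. (y x \<bullet> b) *\<^sub>R B' b h + (y' h \<bullet> b) *\<^sub>R B x b)) (at x within S)"
    by (intro has_derivative_sum has_derivative_scaleR has_derivative_inner_left B y)
  then show "((\<lambda>z. \<Sum>b\<in>Basis. (y z \<bullet> b) *\<^sub>R B z b) has_derivative
          (\<lambda>h. B x (y' h) + (\<Sum>b\<in>Basis. (y x \<bullet> b) *\<^sub>R B' b h))) (at x within S)"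
    unfolding linear_eq_sum_Basis[OF lin[OF x], of "y' _"] by (simp add: sum.distrib add.commute)
qed

lemma continuous_on_linear_apply:
  fixes B :: "'c::topological_space \<Rightarrow> 'a::euclidean_space \<Rightarrow> 'b::real_normed_vector"
  assumes "\<And>z. z \<in> S \<Longrightarrow> linear (B z)"
    and "\<And>v. continuous_on S (\<lambda>z. B z v)" "continuous_on S y"
  shows "continuous_on S (\<lambda>z. B z (y z))"
proof -
  have "continuous_on S (\<lambda>z. \<Sum>b\<in>Basis. (y z \<bullet> b) *\<^sub>R B z b)"
    by (intro continuous_intros assms)
  then show ?thesis
    by (rule continuous_on_eq) (rule linear_eq_sum_Basis[OF assms(1), symmetric])
qed

lemma continuous_on_adjoint_apply:
  fixes B :: "'c::topological_space \<Rightarrow> 'a::euclidean_space \<Rightarrow> 'b::euclidean_space"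
  assumes "\<And>z. z \<in> S \<Longrightarrow> linear (B z)"
    and "\<And>v. continuous_on S (\<lambda>z. B z v)" "continuous_on S y"
  shows "continuous_on S (\<lambda>z. adjoint (B z) (y z))"
proof -
  have "continuous_on S (\<lambda>z. \<Sum>b\<in>Basis. (B z b \<bullet> y z) *\<^sub>R b)"
    by (intro continuous_intros assms)
  then show ?thesis
    by (rule continuous_on_eq) (rule adjoint_eq_sum_Basis[OF assms(1), symmetric])
qed

lemma compact_linear_family_bounded:
  fixes B :: "'c::topological_space \<Rightarrow> 'a::euclidean_space \<Rightarrow> 'b::real_normed_vector"
  assumes K: "compact K"
    and lin: "\<And>z. z \<in> K \<Longrightarrow> linear (B z)"
    and cont: "\<And>v. continuous_on K (\<lambda>z. B z v)"
  obtains L where "L > 0" "\<And>z v. z \<in> K \<Longrightarrow> norm (B z v) \<le> L * norm v"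
proof -
  have "\<forall>b. \<exists>M. \<forall>z\<in>K. norm (B z b) \<le> M"
  proof
    fix b
    have "bounded ((\<lambda>z. B z b) ` K)"
      by (intro compact_imp_bounded compact_continuous_image cont K)
    then show "\<exists>M. \<forall>z\<in>K. norm (B z b) \<le> M" unfolding bounded_iff by blast
  qed
  then obtain M where M: "\<And>b z. z \<in> K \<Longrightarrow> norm (B z b) \<le> M b" by metis
  define L where "L = 1 + (\<Sum>b\<in>Basis. \<bar>M b\<bar>)"
  show ?thesis
  proof
    show "L > 0" unfolding L_def by (smt (verit) sum_nonneg abs_ge_zero)
    fix z v assume z: "z \<in> K"
    have "norm (B z v) = norm (\<Sum>b\<in>Basis. (v \<bullet> b) *\<^sub>R B z b)"
      by (subst linear_eq_sum_Basis[OF lin[OF z]]) (rule refl)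
    also have "\<dots> \<le> (\<Sum>b\<in>Basis. norm v * \<bar>M b\<bar>)"
    proof (rule sum_norm_le)
      fix b :: 'a assume "b \<in> Basis"
      have "norm ((v \<bullet> b) *\<^sub>R B z b) = \<bar>v \<bullet> b\<bar> * norm (B z b)" by simp
      also have "\<dots> \<le> norm v * \<bar>M b\<bar>"
        using Basis_le_norm[OF \<open>b \<in> Basis\<close>, of v] M[OF z, of b] by (intro mult_mono) auto
      finally show "norm ((v \<bullet> b) *\<^sub>R B z b) \<le> norm v * \<bar>M b\<bar>" .
    qed
    also have "\<dots> \<le> L * norm v"
      by (simp add: L_def algebra_simps flip: sum_distrib_left)
    finally show "norm (B z v) \<le> L * norm v" .
  qed
qed

lemma has_vector_derivative_componentwise:
  fixes f :: "real \<Rightarrow> 'a::euclidean_space"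
  assumes "\<And>b. b \<in> Basis \<Longrightarrow> ((\<lambda>s. f s \<bullet> b) has_vector_derivative f' \<bullet> b) (at t within S)"
  shows "(f has_vector_derivative f') (at t within S)"
  using assms unfolding has_vector_derivative_def
  by (subst has_derivative_componentwise_within) simp

lemma has_vector_derivative_imp_continuous_on:
  assumes "\<And>t. t \<in> S \<Longrightarrow> (f has_vector_derivative f' t) (at t within S)"
  shows "continuous_on S f"
  using assms has_vector_derivative_continuous continuous_on_eq_continuous_within by blast

section \<open>Ordinary differential equations\<close>

text \<open>
  The solution is the Peano-Baker series. Its terms are the iterated integrals \<open>y (k + 1) t\<close> of
  \<open>B s (y k s)\<close> over \<open>a \<le> s \<le> t\<close>, with \<open>y 0 = v\<close>. On an interval this short each integration at least
  halves the bound, so the series and its termwise derivative are dominated by a geometric series.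
\<close>
lemma linear_ode_exists:
  fixes B :: "real \<Rightarrow> 'a::euclidean_space \<Rightarrow> 'a"
  assumes ab: "a \<le> b"
    and lin: "\<And>t. t \<in> {a..b} \<Longrightarrow> linear (B t)"
    and cont: "\<And>v. continuous_on {a..b} (\<lambda>t. B t v)"
    and K: "\<And>t v. t \<in> {a..b} \<Longrightarrow> norm (B t v) \<le> K * norm v" and "0 \<le> K" and short: "K * (b - a) \<le> 1 / 2"
  obtains y where "y a = v"
    "\<And>t. t \<in> {a..b} \<Longrightarrow> (y has_vector_derivative B t (y t)) (at t within {a..b})"
proof -
  define y where "y = rec_nat (\<lambda>_. v) (\<lambda>_ w t. integral {a..t} (\<lambda>s. B s (w s)))"
  have y0: "y 0 = (\<lambda>_. v)" and ySuc: "y (Suc k) = (\<lambda>t. integral {a..t} (\<lambda>s. B s (y k s)))" for k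
    by (simp_all add: y_def)
  have step: "continuous_on {a..b} (y k) \<Longrightarrow>
      (y (Suc k) has_vector_derivative B t (y k t)) (at t within {a..b})" if "t \<in> {a..b}" for k t
    unfolding ySuc
    by (rule integral_has_vector_derivative[OF continuous_on_linear_apply that]) (auto intro: lin cont)
  have ycont: "continuous_on {a..b} (y k)" for k
  proof (induction k)
    case 0
    show ?case by (simp add: y0)
  next
    case (Suc k)
    show ?case
      using step[OF _ Suc] by (intro has_vector_derivative_imp_continuous_on) auto
  qed
  have bound: "norm (y k t) \<le> norm v * (1/2)^k" if "t \<in> {a..b}" for k t
    using that
  proof (induction k arbitrary: t)
    case 0
    then show ?case by (simp add: y0)
  next
    case (Suc k)
    have "norm (integral {a..t} (\<lambda>s. B s (y k s))) \<le> K * (norm v * (1/2)^k) * (t - a)"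
    proof (rule integral_bound)
      show "a \<le> t" using Suc.prems by simp
      show "continuous_on {a..t} (\<lambda>s. B s (y k s))"
        using Suc.prems
        by (intro continuous_on_subset[OF continuous_on_linear_apply[of "{a..b}" B "y k"]] lin cont ycont) auto
      fix s assume "s \<in> {a..t}"
      then have s: "s \<in> {a..b}" using Suc.prems by auto
      show "norm (B s (y k s)) \<le> K * (norm v * (1/2)^k)"
        using K[OF s, of "y k s"] mult_left_mono[OF Suc.IH[OF s] \<open>0 \<le> K\<close>] by linarith
    qed
    also have "\<dots> = (norm v * (1/2)^k) * (K * (t - a))" by simp
    also have "\<dots> \<le> (norm v * (1/2)^k) * (1/2)"
    proof (intro mult_left_mono)
      have "K * (t - a) \<le> K * (b - a)" using Suc.prems \<open>0 \<le> K\<close> by (intro mult_left_mono) auto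
      then show "K * (t - a) \<le> 1 / 2" using short by linarith
    qed simp
    finally show ?case by (simp add: ySuc)
  qed
  define Y where "Y = (\<lambda>t. \<Sum>k. y k t)"
  have summ: "summable (\<lambda>k. norm v * (1/2::real)^k)" by (intro summable_mult summable_geometric) simp
  have unif: "uniform_limit {a..b} (\<lambda>n t. \<Sum>k<n. y k t) Y sequentially"
    unfolding Y_def by (rule Weierstrass_m_test[OF bound summ])
  define f' where "f' = (\<lambda>k t h. case k of 0 \<Rightarrow> (0::'a) | Suc j \<Rightarrow> (h::real) *\<^sub>R B t (y j t))"
  have sums: "(\<lambda>k. y k t) sums Y t" if "t \<in> {a..b}" for t
    unfolding Y_def
    by (intro summable_sums summable_comparison_test[OF _ summ]) (use bound[OF that] in auto)
  have "\<exists>g. \<forall>t\<in>{a..b}. (\<lambda>k. y k t) sums g t \<and> (g has_derivative (\<lambda>h. h *\<^sub>R B t (Y t))) (at t within {a..b})"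
  proof (rule has_derivative_series[where f' = f' and x = a])
    show "(y k has_derivative f' k t) (at t within {a..b})" if "t \<in> {a..b}" for k t
    proof (cases k)
      case 0
      then show ?thesis by (simp add: f'_def y0)
    next
      case (Suc j)
      then show ?thesis using step[OF that ycont, of j] by (simp add: f'_def has_vector_derivative_def)
    qed
    show "\<forall>\<^sub>F n in sequentially. \<forall>t\<in>{a..b}. \<forall>h.
        norm (sum (\<lambda>i. f' i t h) {..<n} - h *\<^sub>R B t (Y t)) \<le> e * norm h" if "e > 0" for e
    proof -
      have "e / (K + 1) > 0" using that \<open>0 \<le> K\<close> by simp
      then have "\<forall>\<^sub>F n in sequentially. \<forall>t\<in>{a..b}. dist (\<Sum>k<n. y k t) (Y t) < e / (K + 1)"
        using unif unfolding uniform_limit_iff by blast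
      then have "\<forall>\<^sub>F n in sequentially. \<forall>t\<in>{a..b}. \<forall>h.
          norm (sum (\<lambda>i. f' i t h) {..<Suc n} - h *\<^sub>R B t (Y t)) \<le> e * norm h"
      proof eventually_elim
        case (elim n)
        show ?case
        proof (intro ballI allI)
          fix t h assume t: "t \<in> {a..b}"
          have "sum (\<lambda>i. f' i t h) {..<Suc n} = (\<Sum>k<n. h *\<^sub>R B t (y k t))"
            unfolding sum.lessThan_Suc_shift by (simp add: f'_def)
          also have "\<dots> = h *\<^sub>R B t (\<Sum>k<n. y k t)"
            by (simp add: linear_sum[OF lin[OF t]] scaleR_sum_right)
          finally have "norm (sum (\<lambda>i. f' i t h) {..<Suc n} - h *\<^sub>R B t (Y t))
              = norm (h *\<^sub>R B t ((\<Sum>k<n. y k t) - Y t))"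
            by (simp add: linear_diff[OF lin[OF t]] scaleR_diff_right)
          also have "\<dots> \<le> \<bar>h\<bar> * (K * norm ((\<Sum>k<n. y k t) - Y t))"
            using K[OF t] by (simp add: mult_left_mono)
          also have "\<dots> \<le> \<bar>h\<bar> * ((K + 1) * (e / (K + 1)))"
            using elim t \<open>0 \<le> K\<close> by (intro mult_left_mono mult_mono) (auto simp: dist_norm less_imp_le)
          also have "\<dots> = e * norm h" using \<open>0 \<le> K\<close> by simp
          finally show "norm (sum (\<lambda>i. f' i t h) {..<Suc n} - h *\<^sub>R B t (Y t)) \<le> e * norm h" .
        qed
      qed
      then show ?thesis
        by (subst eventually_sequentially_Suc[symmetric])
    qed
    show "(\<lambda>k. y k a) sums Y a" using sums ab by simp
  qed (use ab in auto)
  then obtain g where g: "\<And>t. t \<in> {a..b} \<Longrightarrow> (\<lambda>k. y k t) sums g t"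
    "\<And>t. t \<in> {a..b} \<Longrightarrow> (g has_derivative (\<lambda>h. h *\<^sub>R B t (Y t))) (at t within {a..b})"
    by blast
  have gY: "g t = Y t" if "t \<in> {a..b}" for t
    using g(1)[OF that] sums[OF that] sums_unique2 by blast
  have "y k a = (if k = 0 then v else 0)" for k by (cases k) (simp_all add: y0 ySuc)
  then have "(\<lambda>k. y k a) sums v" using sums_If_finite_set[of "{0}" "\<lambda>_. v"] by simp
  then have "g a = v" using g(1)[of a] ab sums_unique2 by auto
  then show ?thesis
    using that[of g] g(2) gY by (simp add: has_vector_derivative_def)
qed

text \<open>
  On a ball around the initial value \<open>F\<close> is Lipschitz, with constant \<open>L\<close> say. If \<open>L * h \<le> 1/2\<close>, the mean
  value inequality bounds the maximum of the distance of the two solutions on \<open>[-h, h]\<close> by half of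
  itself.
\<close>
lemma ode_unique_local:
  fixes F :: "'a::euclidean_space \<Rightarrow> 'a"
  assumes V: "open V"
    and F: "\<And>z. z \<in> V \<Longrightarrow> (F has_derivative F' z) (at z)" "\<And>v. continuous_on V (\<lambda>z. F' z v)"
    and d: "d > 0"
    and x: "\<And>t. \<bar>t\<bar> < d \<Longrightarrow> x t \<in> V" "\<And>t. \<bar>t\<bar> < d \<Longrightarrow> (x has_vector_derivative F (x t)) (at t)"
    and y: "\<And>t. \<bar>t\<bar> < d \<Longrightarrow> y t \<in> V" "\<And>t. \<bar>t\<bar> < d \<Longrightarrow> (y has_vector_derivative F (y t)) (at t)"
    and eq: "x 0 = y 0"
  obtains h where "h > 0" "h \<le> d" "\<And>t. \<bar>t\<bar> < h \<Longrightarrow> x t = y t"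
proof -
  obtain r where r: "r > 0" "cball (x 0) r \<subseteq> V"
    using V[unfolded open_contains_cball] x(1)[of 0] d by auto
  obtain L where L: "L > 0" "\<And>z v. z \<in> cball (x 0) r \<Longrightarrow> norm (F' z v) \<le> L * norm v"
  proof (rule compact_linear_family_bounded[of "cball (x 0) r" F'])
    show "linear (F' z)" if "z \<in> cball (x 0) r" for z
      by (rule has_derivative_linear[OF F(1)]) (use that r in blast)
    show "continuous_on (cball (x 0) r) (\<lambda>z. F' z v)" for v
      by (rule continuous_on_subset[OF F(2) r(2)])
  qed auto
  have lip: "norm (F p - F q) \<le> L * norm (p - q)" if "p \<in> cball (x 0) r" "q \<in> cball (x 0) r" for p q
  proof (rule differentiable_bound[OF convex_cball _ _ that])
    show "(F has_derivative F' z) (at z within cball (x 0) r)" if "z \<in> cball (x 0) r" for z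
      by (rule has_derivative_at_withinI[OF F(1)]) (use that r in blast)
    show "onorm (F' z) \<le> L" if "z \<in> cball (x 0) r" for z
      using L that by (intro onorm_le) auto
  qed
  have cx: "continuous (at 0) x" and cy: "continuous (at 0) y"
    using has_vector_derivative_continuous[OF x(2)[of 0]] has_vector_derivative_continuous[OF y(2)[of 0]] d
    by auto
  obtain h1 where h1: "h1 > 0" "\<And>t. \<bar>t\<bar> < h1 \<Longrightarrow> dist (x t) (x 0) < r"
    using cx[unfolded continuous_at_eps_delta, rule_format, OF r(1)] by auto
  obtain h2 where h2: "h2 > 0" "\<And>t. \<bar>t\<bar> < h2 \<Longrightarrow> dist (y t) (y 0) < r"
    using cy[unfolded continuous_at_eps_delta, rule_format, OF r(1)] by auto
  \<comment> \<open>Small enough for both solutions to stay in the ball, and for the contraction estimate.\<close>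
  define h where "h = Min {h1 / 2, h2 / 2, d / 2, 1 / (2 * L)}"
  have h: "h > 0" "h < h1" "h < h2" "h < d" using h1 h2 d L by (auto simp: h_def)
  have "h \<le> 1 / (2 * L)" by (simp add: h_def)
  then have hL: "L * h \<le> 1 / 2" using L(1) by (simp add: field_simps)
  define w where "w = (\<lambda>t. x t - y t)"
  have w': "(w has_vector_derivative F (x t) - F (y t)) (at t within {-h..h})" if "t \<in> {-h..h}" for t
    unfolding w_def
    by (intro has_vector_derivative_diff x(2)[THEN has_vector_derivative_at_within]
          y(2)[THEN has_vector_derivative_at_within]) (use that h in auto)
  have "continuous_on {-h..h} (\<lambda>t. norm (w t))"
    by (intro continuous_intros has_vector_derivative_imp_continuous_on[OF w'])
  then obtain m where m: "m \<in> {-h..h}" "\<And>t. t \<in> {-h..h} \<Longrightarrow> norm (w t) \<le> norm (w m)"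
    using continuous_attains_sup[of "{-h..h}" "\<lambda>t. norm (w t)"] h by auto
  have "norm (w m - w 0) \<le> (L * norm (w m)) * norm (m - 0)"
  proof (rule differentiable_bound[of "{-h..h}"])
    show "(w has_derivative (\<lambda>k. k *\<^sub>R (F (x t) - F (y t)))) (at t within {-h..h})" if "t \<in> {-h..h}" for t
      using w'[OF that] by (simp add: has_vector_derivative_def)
    show "onorm (\<lambda>k. k *\<^sub>R (F (x t) - F (y t))) \<le> L * norm (w m)" if t: "t \<in> {-h..h}" for t
    proof -
      have "x t \<in> cball (x 0) r" "y t \<in> cball (x 0) r"
        using h1(2)[of t] h2(2)[of t] t h eq by (auto simp: dist_commute less_imp_le)
      then have "norm (F (x t) - F (y t)) \<le> L * norm (w t)" unfolding w_def by (rule lip)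
      also have "\<dots> \<le> L * norm (w m)" using m(2)[OF t] L by simp
      finally have "norm (F (x t) - F (y t)) \<le> L * norm (w m)" .
      then show ?thesis
        by (intro onorm_le) (simp add: mult.commute mult_left_mono)
    qed
  qed (use m h in auto)
  also have "\<dots> \<le> (L * norm (w m)) * h" using m L by (intro mult_left_mono) auto
  also have "\<dots> = (L * h) * norm (w m)" by simp
  also have "\<dots> \<le> 1 / 2 * norm (w m)" using hL by (intro mult_right_mono) auto
  finally have "norm (w m) \<le> 0" using eq by (simp add: w_def)
  then have "w t = 0" if "\<bar>t\<bar> < h" for t
    using m(2)[of t] that by (simp add: abs_less_iff)
  then show ?thesis using that[of h] h by (auto simp: w_def)
qed

section \<open>Functions of class \<open>C\<^sup>k\<close>\<close>

lemma Ck_SucI: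
  assumes "\<And>x. x \<in> S \<Longrightarrow> (f has_derivative f' x) (at x within S)" "\<And>v. Ck k (\<lambda>x. f' x v) S"
  shows "Ck (Suc k) f S"
  unfolding Ck.simps(2) using assms by blast

lemma Ck_SucE:
  assumes "Ck (Suc k) f S"
  obtains f' where "\<And>x. x \<in> S \<Longrightarrow> (f has_derivative f' x) (at x within S)" "\<And>v. Ck k (\<lambda>x. f' x v) S"
  using assms unfolding Ck.simps(2) by blast

lemma Ck_cong: "(\<And>x. x \<in> S \<Longrightarrow> f x = g x) \<Longrightarrow> Ck k f S \<Longrightarrow> Ck k g S"
proof (cases k)
  case 0
  assume "\<And>x. x \<in> S \<Longrightarrow> f x = g x" "Ck k f S"
  then show ?thesis using 0 by (auto cong: continuous_on_cong)
next
  case (Suc j)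
  assume eq: "\<And>x. x \<in> S \<Longrightarrow> f x = g x" and f: "Ck k f S"
  from f obtain f' where f': "\<And>x. x \<in> S \<Longrightarrow> (f has_derivative f' x) (at x within S)"
    "\<And>v. Ck j (\<lambda>x. f' x v) S" unfolding Suc by (rule Ck_SucE) (rule that)
  have "(g has_derivative f' x) (at x within S)" if "x \<in> S" for x
    by (rule has_derivative_transform[OF that _ f'(1)[OF that]]) (use eq in simp)
  then show ?thesis unfolding Suc by (rule Ck_SucI[OF _ f'(2)])
qed

lemma Ck_Suc_imp: "Ck (Suc k) f S \<Longrightarrow> Ck k f S"
proof (induction k arbitrary: f)
  case 0
  then obtain f' where "\<And>x. x \<in> S \<Longrightarrow> (f has_derivative f' x) (at x within S)"
    by (rule Ck_SucE) (rule that)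
  then show ?case by (auto simp: continuous_on_eq_continuous_within intro: has_derivative_continuous)
next
  case (Suc k)
  from Suc.prems obtain f' where f': "\<And>x. x \<in> S \<Longrightarrow> (f has_derivative f' x) (at x within S)"
    "\<And>v. Ck (Suc k) (\<lambda>x. f' x v) S"
    by (rule Ck_SucE) (rule that)
  show ?case by (rule Ck_SucI[OF f'(1) Suc.IH[OF f'(2)]])
qed

lemma Ck_mono: "Ck m f S \<Longrightarrow> k \<le> m \<Longrightarrow> Ck k f S"
proof (induction m)
  case (Suc m)
  show ?case
  proof (cases "k = Suc m")
    case True
    then show ?thesis using Suc.prems by blast
  next
    case False
    then show ?thesis using Suc.IH[OF Ck_Suc_imp[OF Suc.prems(1)]] Suc.prems(2) by simp
  qed
qed simp

lemma Ck_subset: "Ck k f S \<Longrightarrow> T \<subseteq> S \<Longrightarrow> Ck k f T"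
proof (induction k arbitrary: f)
  case 0
  then show ?case by (simp add: continuous_on_subset)
next
  case (Suc k)
  obtain f' where f': "\<And>x. x \<in> S \<Longrightarrow> (f has_derivative f' x) (at x within S)" "\<And>v. Ck k (\<lambda>x. f' x v) S"
    using Suc.prems(1) by (rule Ck_SucE) (rule that)
  show ?case
  proof (rule Ck_SucI)
    show "(f has_derivative f' x) (at x within T)" if "x \<in> T" for x
      by (rule has_derivative_subset[OF f'(1) Suc.prems(2)]) (use that Suc.prems(2) in blast)
    show "Ck k (\<lambda>x. f' x v) T" for v by (rule Suc.IH[OF f'(2) Suc.prems(2)])
  qed
qed

lemma Ck_imp_continuous_on: "Ck k f S \<Longrightarrow> continuous_on S f"
  using Ck_mono[of k f S 0] by simp

lemma
  assumes "open S" "Ck (Suc k) f S"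
  shows Ck_Suc_has_derivative: "x \<in> S \<Longrightarrow> (f has_derivative frechet_derivative f (at x)) (at x)"
    and Ck_Suc_frechet_derivative: "Ck k (\<lambda>x. frechet_derivative f (at x) v) S"
proof -
  from assms(2) obtain f' where f': "\<And>x. x \<in> S \<Longrightarrow> (f has_derivative f' x) (at x within S)"
    "\<And>v. Ck k (\<lambda>x. f' x v) S" by (rule Ck_SucE) (rule that)
  have f: "(f has_derivative f' x) (at x)" if "x \<in> S" for x
    using f'(1)[OF that] unfolding at_within_open[OF that assms(1)] .
  have eq: "frechet_derivative f (at x) = f' x" if "x \<in> S" for x
    by (rule frechet_derivative_at[OF f[OF that], symmetric])
  show "(f has_derivative frechet_derivative f (at x)) (at x)" if "x \<in> S" for x
    using f[OF that] eq[OF that] by simp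
  show "Ck k (\<lambda>x. frechet_derivative f (at x) v) S" for v
    by (rule Ck_cong[OF _ f'(2)[of v]]) (simp add: eq)
qed

lemma second_frechet_derivative_symmetric:
  fixes f :: "'a::euclidean_space \<Rightarrow> 'b::euclidean_space"
  assumes "open S" "x \<in> S" "Ck (Suc (Suc k)) f S"
  shows "frechet_derivative (\<lambda>y. frechet_derivative f (at y) u) (at x) v =
         frechet_derivative (\<lambda>y. frechet_derivative f (at y) v) (at x) u"
proof -
  note D = Ck_Suc_frechet_derivative[OF assms(1,3)]
  show ?thesis
    by (rule second_derivative_symmetric[OF assms(1,2), where f = f,
          OF Ck_Suc_has_derivative[OF assms(1,3)] Ck_Suc_has_derivative[OF assms(1) D]
             Ck_imp_continuous_on[OF Ck_Suc_frechet_derivative[OF assms(1) D]]])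
qed

text \<open>
  At the closed end \<open>\<epsilon> = 0\<close> of the parameter interval the family is only differentiable within
  \<open>{0..<e} \<times> V\<close>. That suffices for the directions tangent to the slice.
\<close>
lemma Ck_slice:
  assumes "e > 0" "open V" "Ck (Suc k) (\<lambda>(\<epsilon>::real, x). f \<epsilon> x) ({0..<e} \<times> V)"
  shows "Ck 1 (f 0) V"
proof -
  obtain f' where f': "\<And>z. z \<in> {0..<e} \<times> V \<Longrightarrow> ((\<lambda>(\<epsilon>, x). f \<epsilon> x) has_derivative f' z) (at z within {0..<e} \<times> V)"
    "\<And>v. Ck k (\<lambda>z. f' z v) ({0..<e} \<times> V)"
    using assms(3) by (rule Ck_SucE) (rule that)
  have "(f 0 has_derivative (\<lambda>v. f' (0, x) (0, v))) (at x within V)" if x: "x \<in> V" for x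
  proof -
    have d: "((\<lambda>x. (0::real, x)) has_derivative (\<lambda>v. (0, v))) (at x within V)"
      by (auto intro!: derivative_eq_intros)
    have sub: "Pair 0 ` V \<subseteq> {0..<e} \<times> V" using assms(1) by auto
    show ?thesis using has_derivative_in_compose2[OF f'(1) sub x d] by simp
  qed
  moreover have "continuous_on V (\<lambda>x. f' (0, x) (0, v))" for v
    by (rule continuous_on_compose2[OF Ck_imp_continuous_on[OF f'(2)]])
      (use assms(1) in \<open>auto intro!: continuous_intros\<close>)
  ultimately show ?thesis unfolding One_nat_def by (intro Ck_SucI) simp_all
qed

section \<open>Fields on a manifold\<close>

lemma vector_field_on_subset: "vector_field_on A W F \<Longrightarrow> W' \<subseteq> W \<Longrightarrow> vector_field_on A W' F"
  unfolding vector_field_on_def by blast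

lemma Ck_field_on_subset: "Ck_field_on A k W F \<Longrightarrow> W' \<subseteq> W \<Longrightarrow> Ck_field_on A k W' F"
  unfolding Ck_field_on_def using Ck_subset by (meson Int_mono image_mono order_refl)

lemma Ck_field_on_mono: "Ck_field_on A m W F \<Longrightarrow> k \<le> m \<Longrightarrow> Ck_field_on A k W F"
  unfolding Ck_field_on_def using Ck_mono by blast

text \<open>
  Class \<open>C\<^sup>2\<close> is what the Lie bracket and the transport of covectors use: their chart independence is a
  statement about the second derivatives of the coordinate changes.
\<close>
locale C2_atlas =
  fixes A :: "('m::t2_space, 'n::finite) chart set" and k :: nat
  assumes manifold: "oriented_manifold k A" and two_le: "2 \<le> k"
begin

lemma chart_at: obtains c where "c \<in> A" "p \<in> cdom c"
proof -
  have "p \<in> (\<Union>c\<in>A. cdom c)" using manifold unfolding oriented_manifold_def by simp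
  then show ?thesis using that by blast
qed

context
  fixes c assumes c: "c \<in> A"
begin

lemma open_cdom: "open (cdom c)"
  and open_cmap_cdom: "open (cmap c ` cdom c)"
  and homeomorphism_cmap: "homeomorphism (cdom c) (cmap c ` cdom c) (cmap c) (cinv c)"
  using manifold c unfolding oriented_manifold_def by blast+

lemma cinv_cmap: "p \<in> cdom c \<Longrightarrow> cinv c (cmap c p) = p"
  using homeomorphism_cmap unfolding homeomorphism_def by blast

lemma continuous_on_cmap: "continuous_on (cdom c) (cmap c)"
  and continuous_on_cinv: "continuous_on (cmap c ` cdom c) (cinv c)"
  using homeomorphism_cmap unfolding homeomorphism_def by blast+

lemma open_cmap_image:
  assumes "open W"
  shows "open (cmap c ` (cdom c \<inter> W))"
proof -
  have "cmap c ` (cdom c \<inter> W) = cmap c ` cdom c \<inter> cinv c -` W"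
    using cinv_cmap by force
  then show ?thesis
    using continuous_open_preimage[OF continuous_on_cinv open_cmap_cdom assms] by simp
qed

lemma local_rep_cmap: "p \<in> cdom c \<Longrightarrow> local_rep F c (cmap c p) = F c p"
  by (simp add: local_rep_def cinv_cmap)

lemma
  assumes W: "open W" and F: "Ck_field_on A 1 W F"
  shows has_derivative_local_rep:
      "p \<in> cdom c \<inter> W \<Longrightarrow> (local_rep F c has_derivative dfield F c p) (at (cmap c p))"
    and linear_dfield: "p \<in> cdom c \<inter> W \<Longrightarrow> linear (dfield F c p)"
    and continuous_on_dfield: "continuous_on (cdom c \<inter> W) (\<lambda>p. dfield F c p v)"
    and continuous_on_field: "continuous_on (cdom c \<inter> W) (F c)"
proof -
  have Ck: "Ck (Suc 0) (local_rep F c) (cmap c ` (cdom c \<inter> W))"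
    using F c unfolding Ck_field_on_def by simp
  note op = open_cmap_image[OF W]
  show der: "(local_rep F c has_derivative dfield F c p) (at (cmap c p))" if "p \<in> cdom c \<inter> W" for p
    unfolding dfield_def using Ck_Suc_has_derivative[OF op Ck] that by blast
  show "linear (dfield F c p)" if "p \<in> cdom c \<inter> W"
    by (rule has_derivative_linear[OF der[OF that]])
  have cm: "continuous_on (cdom c \<inter> W) (cmap c)"
    by (rule continuous_on_subset[OF continuous_on_cmap]) blast
  show "continuous_on (cdom c \<inter> W) (\<lambda>p. dfield F c p v)"
    unfolding dfield_def
    by (rule continuous_on_compose2[OF Ck_imp_continuous_on[OF Ck_Suc_frechet_derivative[OF op Ck]] cm]) simp
  have "continuous_on (cdom c \<inter> W) (\<lambda>p. local_rep F c (cmap c p))"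
    by (rule continuous_on_compose2[OF Ck_imp_continuous_on[OF Ck] cm]) simp
  then show "continuous_on (cdom c \<inter> W) (F c)"
    by (rule continuous_on_eq) (simp add: local_rep_cmap)
qed

lemma continuous_on_lie_bracket:
  assumes W: "open W" and F: "Ck_field_on A 1 W F" and G: "Ck_field_on A 1 W G"
  shows "continuous_on (cdom c \<inter> W) (lie_bracket F G c)"
proof -
  have "continuous_on (cdom c \<inter> W) (\<lambda>p. dfield G c p (F c p))"
    by (rule continuous_on_linear_apply[OF linear_dfield[OF W G] continuous_on_dfield[OF W G] continuous_on_field[OF W F]])
  moreover have "continuous_on (cdom c \<inter> W) (\<lambda>p. dfield F c p (G c p))"
    by (rule continuous_on_linear_apply[OF linear_dfield[OF W F] continuous_on_dfield[OF W F] continuous_on_field[OF W G]])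
  ultimately show ?thesis unfolding lie_bracket_def by (rule continuous_on_diff)
qed

end

definition ddtransition ::
    "('m, 'n) chart \<Rightarrow> ('m, 'n) chart \<Rightarrow> 'm \<Rightarrow> real ^ 'n \<Rightarrow> real ^ 'n \<Rightarrow> real ^ 'n" where
  "ddtransition c c' p u =
     frechet_derivative (\<lambda>x. frechet_derivative (transition c c') (at x) u) (at (cmap c p))"

context
  fixes c c' assumes cc': "c \<in> A" "c' \<in> A"
begin

lemma transition_cmap: "p \<in> cdom c \<Longrightarrow> transition c c' (cmap c p) = cmap c' p"
  by (simp add: transition_def cinv_cmap cc')

lemma Ck_transition: "Ck (Suc (Suc 0)) (transition c c') (cmap c ` (cdom c \<inter> cdom c'))"
proof -
  have "Ck k (transition c c') (cmap c ` (cdom c \<inter> cdom c'))"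
    using manifold cc' unfolding oriented_manifold_def by blast
  then show ?thesis by (rule Ck_mono) (use two_le in simp)
qed

lemma open_overlap: "open (cmap c ` (cdom c \<inter> cdom c'))"
  by (rule open_cmap_image) (simp_all add: cc' open_cdom)

lemma continuous_on_second_derivative_transition:
  "continuous_on (cmap c ` (cdom c \<inter> cdom c'))
     (\<lambda>x. frechet_derivative (\<lambda>y. frechet_derivative (transition c c') (at y) u) (at x) v)"
  by (rule Ck_imp_continuous_on[OF Ck_Suc_frechet_derivative[OF open_overlap
        Ck_Suc_frechet_derivative[OF open_overlap Ck_transition]]])

context
  fixes p assumes p: "p \<in> cdom c \<inter> cdom c'"
begin

lemma has_derivative_transition: "(transition c c' has_derivative dtransition c c' p) (at (cmap c p))"
  unfolding dtransition_def by (rule Ck_Suc_has_derivative[OF open_overlap Ck_transition imageI[OF p]])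

lemma linear_dtransition: "linear (dtransition c c' p)"
  by (rule has_derivative_linear[OF has_derivative_transition])

lemma has_derivative_dtransition:
  "((\<lambda>x. frechet_derivative (transition c c') (at x) u) has_derivative ddtransition c c' p u) (at (cmap c p))"
  unfolding ddtransition_def
  by (rule Ck_Suc_has_derivative[OF open_overlap Ck_Suc_frechet_derivative[OF open_overlap Ck_transition] imageI[OF p]])

lemma linear_ddtransition: "linear (ddtransition c c' p u)"
  by (rule has_derivative_linear[OF has_derivative_dtransition])

lemma ddtransition_symmetric: "ddtransition c c' p u v = ddtransition c c' p v u"
  unfolding ddtransition_def
  by (rule second_frechet_derivative_symmetric[OF open_overlap imageI[OF p] Ck_transition])

text \<open>
  Derivatives of components do not transform tensorially: differentiating the transformation law of \<open>F\<close>
  leaves the second derivative of the coordinate change as an extra term. The chart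
  independence of the Lie bracket and of the adjoint variational equation is the cancellation of such
  terms.
\<close>
lemma dfield_transition:
  assumes W: "open W" "p \<in> W" and F: "vector_field_on A W F" "Ck_field_on A 1 W F"
  shows "dfield F c' p (dtransition c c' p v) =
         dtransition c c' p (dfield F c p v) + ddtransition c c' p v (F c p)"
proof -
  define S where "S = cmap c ` (cdom c \<inter> (cdom c' \<inter> W))"
  have S: "open S" unfolding S_def by (intro open_cmap_image open_Int open_cdom W cc')
  have xS: "cmap c p \<in> S" using p W by (auto simp: S_def)
  have eq: "local_rep F c' (transition c c' x) = frechet_derivative (transition c c') (at x) (local_rep F c x)"
    if "x \<in> S" for x
  proof -
    obtain q where q: "q \<in> cdom c" "q \<in> cdom c'" "q \<in> W" "x = cmap c q" using \<open>x \<in> S\<close> by (auto simp: S_def)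
    then have "F c' q = dtransition c c' q (F c q)" using F(1) cc' unfolding vector_field_on_def by blast
    then show ?thesis using q by (simp add: transition_cmap local_rep_cmap cc' dtransition_def)
  qed
  have lin: "linear (frechet_derivative (transition c c') (at x))" if "x \<in> S" for x
  proof -
    have "x \<in> cmap c ` (cdom c \<inter> cdom c')" using that by (auto simp: S_def)
    then show ?thesis
      by (rule has_derivative_linear[OF Ck_Suc_has_derivative[OF open_overlap Ck_transition]])
  qed
  have F'c': "(local_rep F c' has_derivative dfield F c' p) (at (transition c c' (cmap c p)))"
    unfolding transition_cmap[OF IntD1[OF p]]
    by (rule has_derivative_local_rep[OF cc'(2) W(1) F(2) IntI[OF IntD2[OF p] W(2)]])
  have "((\<lambda>x. local_rep F c' (transition c c' x)) has_derivative
          (\<lambda>v. dfield F c' p (dtransition c c' p v))) (at (cmap c p))"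
    by (rule has_derivative_compose[OF has_derivative_transition F'c'])
  then have lhs: "((\<lambda>x. frechet_derivative (transition c c') (at x) (local_rep F c x)) has_derivative
          (\<lambda>v. dfield F c' p (dtransition c c' p v))) (at (cmap c p))"
    by (rule has_derivative_transform_within_open[OF _ S xS]) (rule eq)
  have "((\<lambda>x. frechet_derivative (transition c c') (at x) (local_rep F c x)) has_derivative
          (\<lambda>v. frechet_derivative (transition c c') (at (cmap c p)) (dfield F c p v) +
            (\<Sum>b\<in>Basis. (local_rep F c (cmap c p) \<bullet> b) *\<^sub>R ddtransition c c' p b v))) (at (cmap c p) within S)"
    by (rule has_derivative_linear_apply[OF xS lin has_derivative_at_withinI[OF has_derivative_dtransition]
          has_derivative_at_withinI[OF has_derivative_local_rep[OF cc'(1) W(1) F(2) IntI[OF IntD1[OF p] W(2)]]]])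
  moreover have "(\<Sum>b\<in>Basis. (local_rep F c (cmap c p) \<bullet> b) *\<^sub>R ddtransition c c' p b v)
      = ddtransition c c' p v (F c p)" for v
  proof -
    have "(\<Sum>b\<in>Basis. (F c p \<bullet> b) *\<^sub>R ddtransition c c' p v b) = ddtransition c c' p v (F c p)"
      by (rule linear_eq_sum_Basis[OF linear_ddtransition, symmetric])
    moreover have "local_rep F c (cmap c p) = F c p" by (rule local_rep_cmap) (use p cc' in auto)
    ultimately show ?thesis unfolding ddtransition_symmetric[of _ v] by simp
  qed
  ultimately have "((\<lambda>x. frechet_derivative (transition c c') (at x) (local_rep F c x)) has_derivative
          (\<lambda>v. dtransition c c' p (dfield F c p v) + ddtransition c c' p v (F c p))) (at (cmap c p))"
    unfolding at_within_open[OF xS S] by (simp add: dtransition_def)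
  from has_derivative_unique[OF lhs this] show ?thesis by (rule fun_cong)
qed

text \<open>
  The two halves of the bracket contribute the second derivative of the coordinate change at
  \<open>(F, G)\<close> and at \<open>(G, F)\<close> with opposite signs, and these terms cancel.
\<close>
lemma lie_bracket_transition:
  assumes W: "open W" "p \<in> W" and F: "vector_field_on A W F" "Ck_field_on A 1 W F"
    and G: "vector_field_on A W G" "Ck_field_on A 1 W G"
  shows "lie_bracket F G c' p = dtransition c c' p (lie_bracket F G c p)"
proof -
  have "F c' p = dtransition c c' p (F c p)" "G c' p = dtransition c c' p (G c p)"
    using F(1) G(1) p W cc' unfolding vector_field_on_def by blast+
  then show ?thesis
    unfolding lie_bracket_def
    by (simp add: dfield_transition[OF W F] dfield_transition[OF W G] linear_diff[OF linear_dtransition]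
        ddtransition_symmetric[of "G c p"])
qed

end
end

lemma dtransition_compose:
  assumes c: "c \<in> A" "c' \<in> A" "c'' \<in> A" and p: "p \<in> cdom c" "p \<in> cdom c'" "p \<in> cdom c''"
  shows "dtransition c c'' p v = dtransition c' c'' p (dtransition c c' p v)"
proof -
  define S where "S = cmap c ` (cdom c \<inter> (cdom c' \<inter> cdom c''))"
  have S: "open S" unfolding S_def by (intro open_cmap_image open_Int open_cdom c)
  have xS: "cmap c p \<in> S" using p by (auto simp: S_def)
  have q: "p \<in> cdom c \<inter> cdom c'" "p \<in> cdom c' \<inter> cdom c''" "p \<in> cdom c \<inter> cdom c''" using p by auto
  have d: "(transition c' c'' has_derivative dtransition c' c'' p) (at (transition c c' (cmap c p)))"
    unfolding transition_cmap[OF c(1,2) p(1)] by (rule has_derivative_transition[OF c(2,3) q(2)])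
  have "((\<lambda>x. transition c' c'' (transition c c' x)) has_derivative
      (\<lambda>v. dtransition c' c'' p (dtransition c c' p v))) (at (cmap c p))"
    by (rule has_derivative_compose[OF has_derivative_transition[OF c(1,2) q(1)] d])
  then have "(transition c c'' has_derivative
      (\<lambda>v. dtransition c' c'' p (dtransition c c' p v))) (at (cmap c p))"
    by (rule has_derivative_transform_within_open[OF _ S xS]) (auto simp: S_def transition_cmap c)
  from has_derivative_unique[OF has_derivative_transition[OF c(1,3) q(3)] this] show ?thesis
    by (rule fun_cong)
qed

lemma dtransition_self:
  assumes c: "c \<in> A" and p: "p \<in> cdom c"
  shows "dtransition c c p v = v"
proof -
  have "cmap c p \<in> cmap c ` cdom c" using p by simp
  then have "(transition c c has_derivative (\<lambda>v. v)) (at (cmap c p))"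
    by (rule has_derivative_transform_within_open[OF has_derivative_ident open_cmap_cdom[OF c]])
      (auto simp: transition_cmap c)
  moreover have "p \<in> cdom c \<inter> cdom c" using p by simp
  ultimately show ?thesis
    using has_derivative_unique[OF has_derivative_transition[OF c c]] by (simp add: fun_eq_iff)
qed

lemma adjoint_dtransition_compose:
  assumes c: "c \<in> A" "c' \<in> A" "c'' \<in> A" and p: "p \<in> cdom c" "p \<in> cdom c'" "p \<in> cdom c''"
  shows "adjoint (dtransition c c'' p) w = adjoint (dtransition c c' p) (adjoint (dtransition c' c'' p) w)"
proof (rule euclidean_eqI)
  fix b :: "real ^ 'n"
  have "linear (dtransition c c'' p)" "linear (dtransition c c' p)" "linear (dtransition c' c'' p)"
    using linear_dtransition c p by blast+
  then show "adjoint (dtransition c c'' p) w \<bullet> b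
      = adjoint (dtransition c c' p) (adjoint (dtransition c' c'' p) w) \<bullet> b"
    using dtransition_compose[OF c p] by (simp add: adjoint_inner)
qed

lemma adjoint_dtransition_self:
  assumes "c \<in> A" "p \<in> cdom c"
  shows "adjoint (dtransition c c p) w = w"
proof (rule euclidean_eqI)
  fix b :: "real ^ 'n"
  have "linear (dtransition c c p)" using linear_dtransition assms by blast
  then show "adjoint (dtransition c c p) w \<bullet> b = w \<bullet> b"
    by (simp add: adjoint_inner dtransition_self[OF assms])
qed

text \<open>
  A covector at \<open>p\<close> is the family of its coordinates in all charts around \<open>p\<close>, in accordance with the
  encoding of 1-forms.
\<close>
definition covector :: "'m \<Rightarrow> (('m, 'n) chart \<Rightarrow> real ^ 'n) \<Rightarrow> bool" where
  "covector p \<xi> \<longleftrightarrow> (\<forall>c\<in>A. \<forall>c'\<in>A. p \<in> cdom c \<longrightarrow> p \<in> cdom c' \<longrightarrow>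
     \<xi> c = adjoint (dtransition c c' p) (\<xi> c'))"

lemma covectorD:
  "covector p \<xi> \<Longrightarrow> c \<in> A \<Longrightarrow> c' \<in> A \<Longrightarrow> p \<in> cdom c \<Longrightarrow> p \<in> cdom c' \<Longrightarrow>
     \<xi> c = adjoint (dtransition c c' p) (\<xi> c')"
  unfolding covector_def by blast

lemma covector_of_coordinates:
  assumes "c' \<in> A" "p \<in> cdom c'"
  shows "covector p (\<lambda>c. adjoint (dtransition c c' p) w)"
  unfolding covector_def using adjoint_dtransition_compose assms by blast

lemma covector_inner_invariant:
  assumes \<xi>: "covector p \<xi>" and Y: "vector_field_on A W Y" "p \<in> W"
    and c: "c \<in> A" "c' \<in> A" "p \<in> cdom c" "p \<in> cdom c'"
  shows "\<xi> c \<bullet> Y c p = \<xi> c' \<bullet> Y c' p"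
proof -
  have "Y c' p = dtransition c c' p (Y c p)"
    using Y c unfolding vector_field_on_def by blast
  moreover have "linear (dtransition c c' p)" using linear_dtransition c by blast
  ultimately show ?thesis using covectorD[OF \<xi> c] by (simp add: adjoint_inner)
qed

end

section \<open>Transport of covectors along a solution\<close>

locale solution_curve = C2_atlas A k
  for A :: "('m::t2_space, 'n::finite) chart set" and k :: nat +
  fixes X :: "('m, 'n) field" and \<gamma> :: "real \<Rightarrow> 'm"
  assumes vector_field: "vector_field_on A UNIV X" and C1: "Ck_field_on A 1 UNIV X"
    and solution: "solution A X \<gamma>"
begin

lemma continuous_curve: "continuous_on S \<gamma>"
  using solution continuous_on_subset unfolding solution_def by blast

lemma curve_has_derivative:
  "c \<in> A \<Longrightarrow> \<gamma> t \<in> cdom c \<Longrightarrow> ((\<lambda>t. cmap c (\<gamma> t)) has_vector_derivative X c (\<gamma> t)) (at t)"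
  using solution unfolding solution_def comp_def by blast

lemma curve_near:
  assumes "open W" "\<gamma> t \<in> W"
  obtains d where "d > 0" "\<And>s. \<bar>s - t\<bar> < d \<Longrightarrow> \<gamma> s \<in> W"
proof -
  have "open (\<gamma> -` W)" by (rule open_vimage[OF assms(1) continuous_curve])
  then obtain d where "d > 0" "\<And>s. dist s t < d \<Longrightarrow> s \<in> \<gamma> -` W"
    unfolding open_dist using assms(2) by blast
  then show ?thesis using that by (auto simp: dist_real_def)
qed

lemma linear_dfield_curve: "c \<in> A \<Longrightarrow> \<gamma> t \<in> cdom c \<Longrightarrow> linear (dfield X c (\<gamma> t))"
  using linear_dfield[OF _ open_UNIV C1] by simp

lemma continuous_on_dfield_curve:
  assumes c: "c \<in> A" and I: "\<And>t. t \<in> I \<Longrightarrow> \<gamma> t \<in> cdom c"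
  shows "continuous_on I (\<lambda>t. dfield X c (\<gamma> t) v)"
  by (rule continuous_on_compose2[OF continuous_on_dfield[OF c open_UNIV C1] continuous_curve]) (use I in auto)

text \<open>
  Solutions are indexed by time and not by the point of the curve, since they need not close up over a
  period.
\<close>
definition adjoint_solution_on :: "real set \<Rightarrow> (('m, 'n) chart \<Rightarrow> real \<Rightarrow> real ^ 'n) \<Rightarrow> bool" where
  "adjoint_solution_on I \<alpha> \<longleftrightarrow>
     (\<forall>t\<in>I. covector (\<gamma> t) (\<lambda>c. \<alpha> c t) \<and>
       (\<forall>c\<in>A. \<gamma> t \<in> cdom c \<longrightarrow>
         (\<alpha> c has_vector_derivative - adjoint (dfield X c (\<gamma> t)) (\<alpha> c t)) (at t within I)))"

lemma
  assumes "adjoint_solution_on I \<alpha>" "t \<in> I"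
  shows adjoint_solution_covector: "covector (\<gamma> t) (\<lambda>c. \<alpha> c t)"
    and adjoint_solution_derivative: "c \<in> A \<Longrightarrow> \<gamma> t \<in> cdom c \<Longrightarrow>
      (\<alpha> c has_vector_derivative - adjoint (dfield X c (\<gamma> t)) (\<alpha> c t)) (at t within I)"
  using assms unfolding adjoint_solution_on_def by blast+

text \<open>
  The equation is invariant because it is dual to the linearised flow of \<open>X\<close>. Tested against a fixed
  vector \<open>v\<close>, the derivative of the Jacobian along the curve contributes a second derivative of the
  coordinate change in the directions \<open>X\<close> and \<open>v\<close>, and the transformation law of \<open>dfield X\<close> contributes
  the same term with the opposite sign.
\<close>
lemma adjoint_equation_transition:
  assumes c: "c \<in> A" "c' \<in> A" and t: "t \<in> I" "\<gamma> t \<in> cdom c" "\<gamma> t \<in> cdom c'"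
    and \<eta>: "(\<eta> has_vector_derivative - adjoint (dfield X c' (\<gamma> t)) (\<eta> t)) (at t within I)"
    and \<zeta>: "\<And>s. s \<in> I \<Longrightarrow> \<gamma> s \<in> cdom c \<Longrightarrow> \<gamma> s \<in> cdom c' \<Longrightarrow> \<zeta> s = adjoint (dtransition c c' (\<gamma> s)) (\<eta> s)"
  shows "(\<zeta> has_vector_derivative - adjoint (dfield X c (\<gamma> t)) (\<zeta> t)) (at t within I)"
proof (rule has_vector_derivative_componentwise)
  fix v :: "real ^ 'n"
  let ?p = "\<gamma> t"
  have p: "?p \<in> cdom c \<inter> cdom c'" using t by simp
  have "((\<lambda>s. frechet_derivative (transition c c') (at (cmap c (\<gamma> s))) v) has_vector_derivative
      ddtransition c c' ?p v (X c ?p)) (at t)"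
  proof -
    have "((\<lambda>s. cmap c (\<gamma> s)) has_derivative (\<lambda>h. h *\<^sub>R X c ?p)) (at t)"
      using curve_has_derivative[OF c(1) t(2)] by (simp add: has_vector_derivative_def)
    from has_derivative_compose[OF this has_derivative_dtransition[OF c p, of v]]
    show ?thesis
      by (simp add: has_vector_derivative_def linear_scale[OF linear_ddtransition[OF c p]])
  qed
  then have tau: "((\<lambda>s. frechet_derivative (transition c c') (at (cmap c (\<gamma> s))) v) has_derivative
      (\<lambda>h. h *\<^sub>R ddtransition c c' ?p v (X c ?p))) (at t within I)"
    unfolding has_vector_derivative_def by (rule has_derivative_at_withinI)
  have D: "((\<lambda>s. \<eta> s \<bullet> frechet_derivative (transition c c') (at (cmap c (\<gamma> s))) v) has_derivative
      (\<lambda>h. h * (\<eta> t \<bullet> ddtransition c c' ?p v (X c ?p)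
            - adjoint (dfield X c' ?p) (\<eta> t) \<bullet> dtransition c c' ?p v))) (at t within I)"
    using has_derivative_inner[OF \<eta>[unfolded has_vector_derivative_def] tau]
    by (simp add: dtransition_def algebra_simps)
  have val: "\<eta> t \<bullet> ddtransition c c' ?p v (X c ?p) - adjoint (dfield X c' ?p) (\<eta> t) \<bullet> dtransition c c' ?p v
      = - adjoint (dfield X c ?p) (\<zeta> t) \<bullet> v"
  proof -
    have "adjoint (dfield X c' ?p) (\<eta> t) \<bullet> dtransition c c' ?p v
        = \<eta> t \<bullet> dtransition c c' ?p (dfield X c ?p v) + \<eta> t \<bullet> ddtransition c c' ?p v (X c ?p)"
      using adjoint_inner[OF linear_dfield_curve[OF c(2) t(3)]]
        dfield_transition[OF c p open_UNIV UNIV_I vector_field C1, of v]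
      by (simp add: inner_add_right)
    moreover have "adjoint (dfield X c ?p) (\<zeta> t) \<bullet> v = \<eta> t \<bullet> dtransition c c' ?p (dfield X c ?p v)"
      using adjoint_inner[OF linear_dfield_curve[OF c(1) t(2)]] adjoint_inner[OF linear_dtransition[OF c p]]
        \<zeta>[OF t] by simp
    ultimately show ?thesis by simp
  qed
  obtain d where d: "d > 0" "\<And>s. \<bar>s - t\<bar> < d \<Longrightarrow> \<gamma> s \<in> cdom c \<inter> cdom c'"
    using curve_near[OF open_Int[OF open_cdom open_cdom] p] c by blast
  have "((\<lambda>s. \<zeta> s \<bullet> v) has_derivative (\<lambda>h. h * (- adjoint (dfield X c ?p) (\<zeta> t) \<bullet> v))) (at t within I)"
  proof (rule has_derivative_transform_within[OF D[unfolded val] d(1) t(1)])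
    fix s assume s: "s \<in> I" "dist s t < d"
    have "\<gamma> s \<in> cdom c \<inter> cdom c'" using d(2) s by (simp add: dist_real_def)
    then show "\<eta> s \<bullet> frechet_derivative (transition c c') (at (cmap c (\<gamma> s))) v = \<zeta> s \<bullet> v"
      using \<zeta>[OF s(1)] adjoint_inner[OF linear_dtransition[OF c]] by (simp add: dtransition_def)
  qed
  then show "((\<lambda>s. \<zeta> s \<bullet> v) has_vector_derivative - adjoint (dfield X c ?p) (\<zeta> t) \<bullet> v) (at t within I)"
    by (simp add: has_vector_derivative_def)
qed

lemma adjoint_solution_on_glue:
  assumes abc: "a \<le> b" "b \<le> c"
    and \<alpha>: "adjoint_solution_on {a..b} \<alpha>" and \<beta>: "adjoint_solution_on {b..c} \<beta>"
    and agree: "\<And>ch. ch \<in> A \<Longrightarrow> \<gamma> b \<in> cdom ch \<Longrightarrow> \<alpha> ch b = \<beta> ch b"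
  shows "adjoint_solution_on {a..c} (\<lambda>ch t. if t \<in> {a..b} then \<alpha> ch t else \<beta> ch t)"
  unfolding adjoint_solution_on_def
proof (intro ballI conjI impI)
  fix t assume t: "t \<in> {a..c}"
  show "covector (\<gamma> t) (\<lambda>ch. if t \<in> {a..b} then \<alpha> ch t else \<beta> ch t)"
    using adjoint_solution_covector[OF \<alpha>, of t] adjoint_solution_covector[OF \<beta>, of t] t
    by (cases "t \<le> b") simp_all
  fix ch assume ch: "ch \<in> A" "\<gamma> t \<in> cdom ch"
  have "((\<lambda>t. if t \<in> {a..b} then \<alpha> ch t else \<beta> ch t) has_vector_derivative
      (if t \<in> {a..b} then - adjoint (dfield X ch (\<gamma> t)) (\<alpha> ch t)
       else - adjoint (dfield X ch (\<gamma> t)) (\<beta> ch t))) (at t within {a..c})"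
  proof (rule has_vector_derivative_If_within_closures)
    have eq: "{a..b} \<union> closure {a..b} \<inter> closure {b..c} = {a..b}"
      "{b..c} \<union> closure {a..b} \<inter> closure {b..c} = {b..c}" by auto
    show "t \<in> {a..b} \<union> {b..c}" "{a..c} = {a..b} \<union> {b..c}" using t abc by auto
    show "(\<alpha> ch has_vector_derivative - adjoint (dfield X ch (\<gamma> t)) (\<alpha> ch t))
        (at t within {a..b} \<union> closure {a..b} \<inter> closure {b..c})"
      if "t \<in> {a..b} \<union> closure {a..b} \<inter> closure {b..c}"
      using that unfolding eq by (intro adjoint_solution_derivative[OF \<alpha>] ch)
    show "(\<beta> ch has_vector_derivative - adjoint (dfield X ch (\<gamma> t)) (\<beta> ch t))
        (at t within {b..c} \<union> closure {a..b} \<inter> closure {b..c})"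
      if "t \<in> {b..c} \<union> closure {a..b} \<inter> closure {b..c}"
      using that unfolding eq by (intro adjoint_solution_derivative[OF \<beta>] ch)
    have "\<alpha> ch t = \<beta> ch t" if "t \<in> closure {a..b}" "t \<in> closure {b..c}"
    proof -
      have "t = b" using that by simp
      then show ?thesis using agree ch by simp
    qed
    then show "t \<in> closure {a..b} \<Longrightarrow> t \<in> closure {b..c} \<Longrightarrow> \<alpha> ch t = \<beta> ch t"
      "t \<in> closure {a..b} \<Longrightarrow> t \<in> closure {b..c} \<Longrightarrow>
        - adjoint (dfield X ch (\<gamma> t)) (\<alpha> ch t) = - adjoint (dfield X ch (\<gamma> t)) (\<beta> ch t)"
      by simp_all
  qed
  then show "((\<lambda>t. if t \<in> {a..b} then \<alpha> ch t else \<beta> ch t) has_vector_derivative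
      - adjoint (dfield X ch (\<gamma> t)) (if t \<in> {a..b} then \<alpha> ch t else \<beta> ch t)) (at t within {a..c})"
    by (simp only: if_distrib[of "\<lambda>w. - adjoint (dfield X ch (\<gamma> t)) w"])
qed

text \<open>
  Near \<open>x\<close> the curve stays in one chart, where the equation is an ordinary linear one; its solution is
  carried to the other charts as a covector. The interval may lie anywhere around \<open>x\<close>, as needed for
  the bisection argument below.
\<close>
lemma adjoint_solution_exists_local:
  "\<exists>d>0. \<forall>a b. a \<le> x \<and> x \<le> b \<and> b - a < d \<longrightarrow>
     (\<forall>\<xi>. covector (\<gamma> a) \<xi> \<longrightarrow>
       (\<exists>\<alpha>. adjoint_solution_on {a..b} \<alpha> \<and> (\<forall>c\<in>A. \<gamma> a \<in> cdom c \<longrightarrow> \<alpha> c a = \<xi> c)))"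
proof -
  obtain c where c: "c \<in> A" "\<gamma> x \<in> cdom c" using chart_at .
  obtain d1 where d1: "d1 > 0" "\<And>s. \<bar>s - x\<bar> < d1 \<Longrightarrow> \<gamma> s \<in> cdom c"
    by (rule curve_near[OF open_cdom[OF c(1)] c(2)]) (rule that)
  define d0 where "d0 = d1 / 2"
  have d0: "d0 > 0" and in_c: "\<And>s. s \<in> {x-d0..x+d0} \<Longrightarrow> \<gamma> s \<in> cdom c"
    using d1 by (auto simp: d0_def)
  define B where "B = (\<lambda>t v. - adjoint (dfield X c (\<gamma> t)) v)"
  have linB: "linear (B t)" if "t \<in> {x-d0..x+d0}" for t
    unfolding B_def
    using linear_compose_neg[OF adjoint_linear[OF linear_dfield_curve[OF c(1) in_c[OF that]]]] .
  have contB: "continuous_on {x-d0..x+d0} (\<lambda>t. B t v)" for v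
    unfolding B_def
    by (intro continuous_on_minus continuous_on_adjoint_apply continuous_on_const
        linear_dfield_curve[OF c(1)] continuous_on_dfield_curve[OF c(1)] in_c)
  obtain K where K: "K > 0" "\<And>t v. t \<in> {x-d0..x+d0} \<Longrightarrow> norm (B t v) \<le> K * norm v"
    using compact_linear_family_bounded[OF compact_Icc linB contB] by blast
  define d where "d = min d0 (1 / (2 * K))"
  have "d > 0" using d0 K by (simp add: d_def)
  moreover have "\<exists>\<alpha>. adjoint_solution_on {a..b} \<alpha> \<and> (\<forall>c\<in>A. \<gamma> a \<in> cdom c \<longrightarrow> \<alpha> c a = \<xi> c)"
    if ab: "a \<le> x \<and> x \<le> b \<and> b - a < d" and \<xi>: "covector (\<gamma> a) \<xi>" for a b \<xi>
  proof -
    have sub: "{a..b} \<subseteq> {x-d0..x+d0}" using ab by (auto simp: d_def)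
    have "K * (b - a) \<le> K * (1 / (2 * K))"
      using ab K by (intro mult_left_mono) (auto simp: d_def)
    then have short: "K * (b - a) \<le> 1 / 2" using K by simp
    obtain y where y: "y a = \<xi> c"
      "\<And>t. t \<in> {a..b} \<Longrightarrow> (y has_vector_derivative B t (y t)) (at t within {a..b})"
    proof (rule linear_ode_exists[of a b B K "\<xi> c"])
      show "a \<le> b" using ab by linarith
      show "linear (B t)" if "t \<in> {a..b}" for t using linB that sub by blast
      show "continuous_on {a..b} (\<lambda>t. B t v)" for v by (rule continuous_on_subset[OF contB sub])
      show "norm (B t v) \<le> K * norm v" if "t \<in> {a..b}" for t v using K(2) that sub by blast
      show "0 \<le> K" using K by simp
      show "K * (b - a) \<le> 1 / 2" by (rule short)
    qed (rule that)
    define \<alpha> where "\<alpha> = (\<lambda>c' t. adjoint (dtransition c' c (\<gamma> t)) (y t))"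
    have "adjoint_solution_on {a..b} \<alpha>"
      unfolding adjoint_solution_on_def
    proof (intro ballI conjI impI)
      fix t assume t: "t \<in> {a..b}"
      have tc: "\<gamma> t \<in> cdom c" using in_c t sub by blast
      show "covector (\<gamma> t) (\<lambda>c. \<alpha> c t)"
        unfolding \<alpha>_def by (rule covector_of_coordinates[OF c(1) tc])
      fix c' assume c': "c' \<in> A" "\<gamma> t \<in> cdom c'"
      show "(\<alpha> c' has_vector_derivative - adjoint (dfield X c' (\<gamma> t)) (\<alpha> c' t)) (at t within {a..b})"
        by (rule adjoint_equation_transition[OF c'(1) c(1) t c'(2) tc y(2)[OF t, unfolded B_def]])
          (simp add: \<alpha>_def)
    qed
    moreover have "\<gamma> a \<in> cdom c" using in_c sub ab by (meson atLeastAtMost_iff order.trans order_refl subsetD)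
    then have "\<alpha> c' a = \<xi> c'" if "c' \<in> A" "\<gamma> a \<in> cdom c'" for c'
      using covectorD[OF \<xi> that(1) c(1) that(2)] y(1) by (simp add: \<alpha>_def)
    ultimately show ?thesis by blast
  qed
  ultimately show ?thesis by blast
qed

lemma adjoint_solution_exists:
  assumes "a \<le> b" "covector (\<gamma> a) \<xi>"
  obtains \<alpha> where "adjoint_solution_on {a..b} \<alpha>" "\<And>c. c \<in> A \<Longrightarrow> \<gamma> a \<in> cdom c \<Longrightarrow> \<alpha> c a = \<xi> c"
proof -
  have "\<forall>\<xi>. covector (\<gamma> a) \<xi> \<longrightarrow>
       (\<exists>\<alpha>. adjoint_solution_on {a..b} \<alpha> \<and> (\<forall>c\<in>A. \<gamma> a \<in> cdom c \<longrightarrow> \<alpha> c a = \<xi> c))"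
    using assms(1)
  proof (induction rule: Bolzano)
    case (trans a b c)
    show ?case
    proof (intro allI impI)
      fix \<xi> assume "covector (\<gamma> a) \<xi>"
      then obtain \<alpha> where \<alpha>: "adjoint_solution_on {a..b} \<alpha>" "\<forall>c\<in>A. \<gamma> a \<in> cdom c \<longrightarrow> \<alpha> c a = \<xi> c"
        using trans.IH(1) by blast
      have "covector (\<gamma> b) (\<lambda>c. \<alpha> c b)"
        by (rule adjoint_solution_covector[OF \<alpha>(1)]) (use trans in simp)
      then obtain \<beta> where \<beta>: "adjoint_solution_on {b..c} \<beta>" "\<forall>c\<in>A. \<gamma> b \<in> cdom c \<longrightarrow> \<beta> c b = \<alpha> c b"
        using trans.IH(2) by meson
      have "adjoint_solution_on {a..c} (\<lambda>ch t. if t \<in> {a..b} then \<alpha> ch t else \<beta> ch t)"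
        by (rule adjoint_solution_on_glue[OF trans.hyps(1,2) \<alpha>(1) \<beta>(1)]) (use \<beta>(2) in simp)
      then show "\<exists>\<alpha>. adjoint_solution_on {a..c} \<alpha> \<and> (\<forall>c\<in>A. \<gamma> a \<in> cdom c \<longrightarrow> \<alpha> c a = \<xi> c)"
        using \<alpha>(2) trans.hyps(1)
        by (intro exI[of _ "\<lambda>ch t. if t \<in> {a..b} then \<alpha> ch t else \<beta> ch t"]) auto
    qed
  next
    case (local x)
    show ?case by (rule adjoint_solution_exists_local)
  qed
  then show ?thesis using assms(2) that by blast
qed

lemma adjoint_solution_on_sum:
  assumes "finite J" "\<And>j. j \<in> J \<Longrightarrow> adjoint_solution_on I (\<alpha> j)"
  shows "adjoint_solution_on I (\<lambda>c t. \<Sum>j\<in>J. r j *\<^sub>R \<alpha> j c t)"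
  unfolding adjoint_solution_on_def
proof (intro ballI conjI impI)
  fix t assume t: "t \<in> I"
  note \<alpha> = assms(2)
  show "covector (\<gamma> t) (\<lambda>c. \<Sum>j\<in>J. r j *\<^sub>R \<alpha> j c t)"
    unfolding covector_def
  proof (intro ballI impI)
    fix c c' assume c: "c \<in> A" "c' \<in> A" "\<gamma> t \<in> cdom c" "\<gamma> t \<in> cdom c'"
    have lin: "linear (adjoint (dtransition c c' (\<gamma> t)))"
      using adjoint_linear linear_dtransition c by blast
    have "(\<Sum>j\<in>J. r j *\<^sub>R \<alpha> j c t) = (\<Sum>j\<in>J. r j *\<^sub>R adjoint (dtransition c c' (\<gamma> t)) (\<alpha> j c' t))"
      using covectorD[OF adjoint_solution_covector[OF \<alpha> t] c] by (intro sum.cong) simp_all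
    then show "(\<Sum>j\<in>J. r j *\<^sub>R \<alpha> j c t) = adjoint (dtransition c c' (\<gamma> t)) (\<Sum>j\<in>J. r j *\<^sub>R \<alpha> j c' t)"
      by (simp add: linear_sum[OF lin] linear_scale[OF lin])
  qed
  fix c assume c: "c \<in> A" "\<gamma> t \<in> cdom c"
  have lin: "linear (adjoint (dfield X c (\<gamma> t)))"
    by (rule adjoint_linear[OF linear_dfield_curve[OF c]])
  have "((\<lambda>t. \<Sum>j\<in>J. r j *\<^sub>R \<alpha> j c t) has_vector_derivative
      (\<Sum>j\<in>J. r j *\<^sub>R - adjoint (dfield X c (\<gamma> t)) (\<alpha> j c t))) (at t within I)"
    by (intro has_vector_derivative_sum bounded_linear.has_vector_derivative[OF bounded_linear_scaleR_right]
        adjoint_solution_derivative[OF \<alpha> t c])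
  then show "((\<lambda>t. \<Sum>j\<in>J. r j *\<^sub>R \<alpha> j c t) has_vector_derivative
      - adjoint (dfield X c (\<gamma> t)) (\<Sum>j\<in>J. r j *\<^sub>R \<alpha> j c t)) (at t within I)"
    by (simp add: linear_sum[OF lin] linear_scale[OF lin] sum_negf)
qed

lemma adjoint_solution_on_cong:
  assumes \<alpha>: "adjoint_solution_on I \<alpha>"
    and eq: "\<And>c t. c \<in> A \<Longrightarrow> t \<in> I \<Longrightarrow> \<gamma> t \<in> cdom c \<Longrightarrow> \<alpha> c t = \<beta> c t"
  shows "adjoint_solution_on I \<beta>"
  unfolding adjoint_solution_on_def
proof (intro ballI conjI impI)
  fix t assume t: "t \<in> I"
  show "covector (\<gamma> t) (\<lambda>c. \<beta> c t)"
    unfolding covector_def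
  proof (intro ballI impI)
    fix c c' assume c: "c \<in> A" "c' \<in> A" "\<gamma> t \<in> cdom c" "\<gamma> t \<in> cdom c'"
    show "\<beta> c t = adjoint (dtransition c c' (\<gamma> t)) (\<beta> c' t)"
      unfolding eq[OF c(1) t c(3), symmetric] eq[OF c(2) t c(4), symmetric]
      by (rule covectorD[OF adjoint_solution_covector[OF \<alpha> t] c])
  qed
  fix c assume c: "c \<in> A" "\<gamma> t \<in> cdom c"
  obtain d where d: "d > 0" "\<And>s. \<bar>s - t\<bar> < d \<Longrightarrow> \<gamma> s \<in> cdom c"
    by (rule curve_near[OF open_cdom[OF c(1)] c(2)]) (rule that)
  have "(\<alpha> c has_vector_derivative - adjoint (dfield X c (\<gamma> t)) (\<beta> c t)) (at t within I)"
    using adjoint_solution_derivative[OF \<alpha> t c] eq[OF c(1) t c(2)] by simp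
  then show "(\<beta> c has_vector_derivative - adjoint (dfield X c (\<gamma> t)) (\<beta> c t)) (at t within I)"
    unfolding has_vector_derivative_def
  proof (rule has_derivative_transform_within[OF _ d(1) t])
    fix s assume "s \<in> I" "dist s t < d"
    then show "\<alpha> c s = \<beta> c s" using eq c(1) d(2)[of s] by (simp add: dist_real_def)
  qed
qed

lemma adjoint_solution_on_shift:
  assumes \<alpha>: "adjoint_solution_on {a..b} \<alpha>" and r: "\<And>t. \<gamma> (t + r) = \<gamma> t"
  shows "adjoint_solution_on {a + r..b + r} (\<lambda>c t. \<alpha> c (t - r))"
  unfolding adjoint_solution_on_def
proof (intro ballI conjI impI)
  fix t assume "t \<in> {a + r..b + r}"
  then have t: "t - r \<in> {a..b}" by auto
  have \<gamma>t: "\<gamma> (t - r) = \<gamma> t" using r[of "t - r"] by simp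
  show "covector (\<gamma> t) (\<lambda>c. \<alpha> c (t - r))"
    using adjoint_solution_covector[OF \<alpha> t] \<gamma>t by simp
  fix c assume c: "c \<in> A" "\<gamma> t \<in> cdom c"
  have "(\<alpha> c has_vector_derivative - adjoint (dfield X c (\<gamma> t)) (\<alpha> c (t - r))) (at (t - r) within {a..b})"
    using adjoint_solution_derivative[OF \<alpha> t] c \<gamma>t by simp
  then have "(\<alpha> c has_vector_derivative - adjoint (dfield X c (\<gamma> t)) (\<alpha> c (t - r)))
      (at (t - r) within (\<lambda>t. t - r) ` {a + r..b + r})"
    by simp
  moreover have "((\<lambda>t. t - r) has_vector_derivative 1) (at t within {a + r..b + r})"
    by (auto intro!: derivative_eq_intros)
  ultimately show "((\<lambda>t. \<alpha> c (t - r)) has_vector_derivative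
      - adjoint (dfield X c (\<gamma> t)) (\<alpha> c (t - r))) (at t within {a + r..b + r})"
    using vector_diff_chain_within[of "\<lambda>t. t - r" 1 t "{a + r..b + r}" "\<alpha> c"] by (simp add: o_def)
qed

definition pairing :: "(('m, 'n) chart \<Rightarrow> real \<Rightarrow> real ^ 'n) \<Rightarrow> ('m, 'n) field \<Rightarrow> real \<Rightarrow> real" where
  "pairing \<alpha> Y t = (let c = (SOME c. c \<in> A \<and> \<gamma> t \<in> cdom c) in \<alpha> c t \<bullet> Y c (\<gamma> t))"

text \<open>
  Vectors and covectors transform dually, so near a given time the pairing may be computed in a single
  chart.
\<close>
lemma pairing_eq:
  assumes \<alpha>: "adjoint_solution_on I \<alpha>" "t \<in> I" and Y: "vector_field_on A W Y" "\<gamma> t \<in> W"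
    and c: "c \<in> A" "\<gamma> t \<in> cdom c"
  shows "pairing \<alpha> Y t = \<alpha> c t \<bullet> Y c (\<gamma> t)"
proof -
  define c' where "c' = (SOME c. c \<in> A \<and> \<gamma> t \<in> cdom c)"
  have c': "c' \<in> A" "\<gamma> t \<in> cdom c'"
    using someI[of "\<lambda>c. c \<in> A \<and> \<gamma> t \<in> cdom c" c] c by (auto simp: c'_def)
  show ?thesis
    unfolding pairing_def c'_def[symmetric] Let_def
    by (rule covector_inner_invariant[OF adjoint_solution_covector[OF \<alpha>] Y c'(1) c(1) c'(2) c(2)])
qed

lemma continuous_on_pairing:
  assumes \<alpha>: "adjoint_solution_on I \<alpha>" and W: "open W" "\<And>t. t \<in> I \<Longrightarrow> \<gamma> t \<in> W"
    and Y: "vector_field_on A W Y" "\<And>c. c \<in> A \<Longrightarrow> continuous_on (cdom c \<inter> W) (Y c)"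
  shows "continuous_on I (pairing \<alpha> Y)"
  unfolding continuous_on_eq_continuous_within
proof
  fix t assume t: "t \<in> I"
  obtain c where c: "c \<in> A" "\<gamma> t \<in> cdom c" using chart_at .
  have tc: "\<gamma> t \<in> cdom c \<inter> W" using W t c by blast
  have op: "open (cdom c \<inter> W)" using open_cdom[OF c(1)] W by blast
  obtain d where d: "d > 0" "\<And>s. \<bar>s - t\<bar> < d \<Longrightarrow> \<gamma> s \<in> cdom c \<inter> W"
    by (rule curve_near[OF op tc]) (rule that)
  have "isCont (Y c) (\<gamma> t)"
    using Y(2)[OF c(1)] op tc continuous_on_eq_continuous_at by blast
  moreover have "continuous (at t within I) \<gamma>"
    using continuous_curve[of I] t unfolding continuous_on_eq_continuous_within by blast
  ultimately have "continuous (at t within I) (\<lambda>s. Y c (\<gamma> s))"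
    by (rule continuous_within_compose3)
  moreover have "continuous (at t within I) (\<alpha> c)"
    by (rule has_vector_derivative_continuous[OF adjoint_solution_derivative[OF \<alpha> t c]])
  ultimately have "continuous (at t within I) (\<lambda>s. \<alpha> c s \<bullet> Y c (\<gamma> s))"
    by (intro continuous_inner)
  then show "continuous (at t within I) (pairing \<alpha> Y)"
  proof (rule continuous_transform_within[OF _ d(1) t])
    fix s assume "s \<in> I" "dist s t < d"
    then show "\<alpha> c s \<bullet> Y c (\<gamma> s) = pairing \<alpha> Y s"
      using pairing_eq[OF \<alpha> _ Y(1) _ c(1), of s] d(2)[of s] by (simp add: dist_real_def)
  qed
qed

text \<open>
  The conservation law behind the dimension count: in a chart, the derivative of \<open>\<alpha>(Y)\<close> along the curve is
  \<open>\<alpha>(DY X) - \<alpha>(DX Y) = \<alpha>([X, Y])\<close>.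
\<close>
lemma pairing_constant:
  assumes \<alpha>: "adjoint_solution_on {a..b} \<alpha>" and W: "open W" "\<And>t. t \<in> {a..b} \<Longrightarrow> \<gamma> t \<in> W"
    and Y: "vector_field_on A W Y" "Ck_field_on A 1 W Y"
    and comm: "\<And>c p. c \<in> A \<Longrightarrow> p \<in> cdom c \<inter> W \<Longrightarrow> lie_bracket X Y c p = 0"
    and s: "s \<in> {a..b}" and t: "t \<in> {a..b}"
  shows "pairing \<alpha> Y s = pairing \<alpha> Y t"
proof (rule has_derivative_zero_unique[OF _ _ s t])
  show "convex {a..b}" by simp
  fix t assume t: "t \<in> {a..b}"
  let ?p = "\<gamma> t"
  obtain c where c: "c \<in> A" "?p \<in> cdom c" using chart_at .
  have tc: "?p \<in> cdom c \<inter> W" using W t c by blast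
  have op: "open (cdom c \<inter> W)" using open_cdom[OF c(1)] W by blast
  obtain d where d: "d > 0" "\<And>s. \<bar>s - t\<bar> < d \<Longrightarrow> \<gamma> s \<in> cdom c \<inter> W"
    by (rule curve_near[OF op tc]) (rule that)
  have "((\<lambda>s. cmap c (\<gamma> s)) has_derivative (\<lambda>h. h *\<^sub>R X c ?p)) (at t)"
    using curve_has_derivative[OF c] by (simp add: has_vector_derivative_def)
  from has_derivative_compose[OF this has_derivative_local_rep[OF c(1) W(1) Y(2) tc]]
  have DY: "((\<lambda>s. local_rep Y c (cmap c (\<gamma> s))) has_derivative (\<lambda>h. h *\<^sub>R dfield Y c ?p (X c ?p)))
      (at t within {a..b})"
    unfolding linear_scale[OF linear_dfield[OF c(1) W(1) Y(2) tc]] by (rule has_derivative_at_withinI)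
  have "((\<lambda>s. \<alpha> c s \<bullet> local_rep Y c (cmap c (\<gamma> s))) has_derivative
      (\<lambda>h. h * (\<alpha> c t \<bullet> dfield Y c ?p (X c ?p) - adjoint (dfield X c ?p) (\<alpha> c t) \<bullet> Y c ?p)))
      (at t within {a..b})"
    using has_derivative_inner[OF adjoint_solution_derivative[OF \<alpha> t c, unfolded has_vector_derivative_def] DY]
    by (simp add: algebra_simps local_rep_cmap[OF c])
  moreover have "\<alpha> c t \<bullet> dfield Y c ?p (X c ?p) - adjoint (dfield X c ?p) (\<alpha> c t) \<bullet> Y c ?p = 0"
    using comm[OF c(1) tc] adjoint_inner[OF linear_dfield_curve[OF c]]
    unfolding lie_bracket_def by simp
  ultimately have "((\<lambda>s. \<alpha> c s \<bullet> local_rep Y c (cmap c (\<gamma> s))) has_derivative (\<lambda>h. 0)) (at t within {a..b})"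
    by simp
  then show "(pairing \<alpha> Y has_derivative (\<lambda>h. 0)) (at t within {a..b})"
  proof (rule has_derivative_transform_within[OF _ d(1) t])
    fix s assume s: "s \<in> {a..b}" "dist s t < d"
    then have "\<gamma> s \<in> cdom c" "\<gamma> s \<in> W" using d(2)[of s] by (simp_all add: dist_real_def)
    then show "\<alpha> c s \<bullet> local_rep Y c (cmap c (\<gamma> s)) = pairing \<alpha> Y s"
      using pairing_eq[OF \<alpha> s(1) Y(1) _ c(1)] local_rep_cmap[OF c(1)] by simp
  qed
qed

end

section \<open>Closed orbits\<close>

context solution_curve
begin

lemma curve_component_derivative:
  assumes "c \<in> A" "\<gamma> t \<in> cdom c"
  shows "((\<lambda>t. cmap c (\<gamma> t) \<bullet> w) has_real_derivative X c (\<gamma> t) \<bullet> w) (at t)"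
  unfolding has_real_derivative_iff_has_vector_derivative
  by (rule bounded_linear.has_vector_derivative[OF bounded_linear_inner_left curve_has_derivative[OF assms]])

lemma curve_meets_itself_local:
  assumes "\<gamma> s = \<gamma> t"
  obtains h where "h > 0" "\<And>r. \<bar>r\<bar> < h \<Longrightarrow> \<gamma> (s + r) = \<gamma> (t + r)"
proof -
  obtain c where c: "c \<in> A" "\<gamma> s \<in> cdom c" using chart_at .
  obtain d1 where d1: "d1 > 0" "\<And>r. \<bar>r - s\<bar> < d1 \<Longrightarrow> \<gamma> r \<in> cdom c"
    by (rule curve_near[OF open_cdom[OF c(1)] c(2)]) (rule that)
  obtain d2 where d2: "d2 > 0" "\<And>r. \<bar>r - t\<bar> < d2 \<Longrightarrow> \<gamma> r \<in> cdom c"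
    by (rule curve_near[OF open_cdom[OF c(1)], of t]) (use c assms that in simp_all)
  define d where "d = min d1 d2"
  have d: "d > 0" using d1 d2 by (simp add: d_def)
  have ins: "\<gamma> (s + r) \<in> cdom c" and int: "\<gamma> (t + r) \<in> cdom c" if "\<bar>r\<bar> < d" for r
    using that d1(2)[of "s + r"] d2(2)[of "t + r"] by (simp_all add: d_def)
  have Ck: "Ck (Suc 0) (local_rep X c) (cmap c ` cdom c)"
    using C1 c unfolding Ck_field_on_def by simp
  note op = open_cmap_cdom[OF c(1)]
  have shift: "((\<lambda>r. cmap c (\<gamma> (a + r))) has_vector_derivative local_rep X c (cmap c (\<gamma> (a + r)))) (at r)"
    if "\<gamma> (a + r) \<in> cdom c" for a r
  proof -
    have "((\<lambda>r. a + r) has_vector_derivative 1) (at r)"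
      by (auto intro!: derivative_eq_intros)
    from vector_diff_chain_at[OF this curve_has_derivative[OF c(1) that]]
    show ?thesis by (simp add: o_def local_rep_cmap[OF c(1) that])
  qed
  obtain h where h: "h > 0" "h \<le> d" "\<And>r. \<bar>r\<bar> < h \<Longrightarrow> cmap c (\<gamma> (s + r)) = cmap c (\<gamma> (t + r))"
  proof (rule ode_unique_local[OF op Ck_Suc_has_derivative[OF op Ck]
        Ck_imp_continuous_on[OF Ck_Suc_frechet_derivative[OF op Ck]] d])
    show "cmap c (\<gamma> (s + r)) \<in> cmap c ` cdom c" "cmap c (\<gamma> (t + r)) \<in> cmap c ` cdom c"
      if "\<bar>r\<bar> < d" for r using ins[OF that] int[OF that] by simp_all
    show "((\<lambda>r. cmap c (\<gamma> (s + r))) has_vector_derivative local_rep X c (cmap c (\<gamma> (s + r)))) (at r)"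
      "((\<lambda>r. cmap c (\<gamma> (t + r))) has_vector_derivative local_rep X c (cmap c (\<gamma> (t + r)))) (at r)"
      if "\<bar>r\<bar> < d" for r using shift ins[OF that] int[OF that] by simp_all
    show "cmap c (\<gamma> (s + 0)) = cmap c (\<gamma> (t + 0))" using assms by simp
  qed (assumption, rule that)
  have "\<gamma> (s + r) = \<gamma> (t + r)" if "\<bar>r\<bar> < h" for r
  proof -
    have "\<bar>r\<bar> < d" using that h(2) by simp
    moreover have "cinv c (cmap c (\<gamma> (s + r))) = cinv c (cmap c (\<gamma> (t + r)))" using h(3)[OF that] by simp
    ultimately show ?thesis using cinv_cmap[OF c(1)] ins int by simp
  qed
  then show ?thesis using that h(1) by blast
qed

text \<open>
  Both shifted curves solve the same equation, so the set of times at which they agree is open by local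
  uniqueness and closed by continuity.
\<close>
lemma curve_meets_itself:
  assumes "\<gamma> s = \<gamma> t"
  shows "\<gamma> (s + r) = \<gamma> (t + r)"
proof -
  define R where "R = {r. \<gamma> (s + r) = \<gamma> (t + r)}"
  have "closed R"
    unfolding R_def
    by (intro closed_Collect_eq continuous_on_compose2[OF continuous_curve[of UNIV]] continuous_intros) auto
  moreover have "open R"
    unfolding open_dist
  proof
    fix r assume "r \<in> R"
    then obtain h where h: "h > 0" "\<And>q. \<bar>q\<bar> < h \<Longrightarrow> \<gamma> (s + r + q) = \<gamma> (t + r + q)"
      unfolding R_def using curve_meets_itself_local by blast
    have "q \<in> R" if "dist q r < h" for q
      using h(2)[of "q - r"] that by (simp add: R_def dist_real_def)
    then show "\<exists>e>0. \<forall>q. dist q r < e \<longrightarrow> q \<in> R" using h(1) by blast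
  qed
  moreover have "0 \<in> R" using assms by (simp add: R_def)
  ultimately have "R = UNIV" using clopen[of R] by blast
  then show ?thesis unfolding R_def by blast
qed

text \<open>
  The times of return to \<open>\<gamma> 0\<close> form a closed subgroup of the reals. It is discrete: since \<open>X\<close> does not
  vanish at \<open>\<gamma> 0\<close>, the component of the curve in the direction of \<open>X\<close> increases there, which keeps
  the curve away from \<open>\<gamma> 0\<close> for a while. The least positive element generates the group.
\<close>
lemma minimal_period:
  assumes T: "T > 0" "\<gamma> T = \<gamma> 0" and c: "c \<in> A" "\<gamma> 0 \<in> cdom c" "X c (\<gamma> 0) \<noteq> 0"
  obtains \<tau> where "\<tau> > 0" "\<And>s t. \<gamma> s = \<gamma> t \<longleftrightarrow> (\<exists>n::int. s - t = of_int n * \<tau>)"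
proof -
  define P where "P = {r. \<gamma> r = \<gamma> 0}"
  have period: "\<gamma> (t + r) = \<gamma> t" if "r \<in> P" for r t
    using curve_meets_itself[of r 0 t] that by (simp add: P_def add.commute)
  have diff: "r - q \<in> P" if "r \<in> P" "q \<in> P" for r q
    using period[OF that(2), of "r - q"] that(1) by (simp add: P_def)
  obtain \<delta> where \<delta>: "\<delta> > 0" "\<And>r. r \<in> P \<Longrightarrow> r > 0 \<Longrightarrow> r \<ge> \<delta>"
  proof -
    have "((\<lambda>r. cmap c (\<gamma> r) \<bullet> X c (\<gamma> 0)) has_real_derivative X c (\<gamma> 0) \<bullet> X c (\<gamma> 0)) (at 0)"
      by (rule curve_component_derivative[OF c(1,2)])
    from DERIV_pos_inc_right[OF this] obtain \<delta> where "\<delta> > 0"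
      "\<And>r. r > 0 \<Longrightarrow> r < \<delta> \<Longrightarrow> cmap c (\<gamma> 0) \<bullet> X c (\<gamma> 0) < cmap c (\<gamma> (0 + r)) \<bullet> X c (\<gamma> 0)"
      using c(3) by auto
    then show ?thesis using that[of \<delta>] by (force simp: P_def)
  qed
  \<comment> \<open>The positive return times; they are at least \<open>\<delta>\<close>, which makes this set closed.\<close>
  define Q where "Q = P \<inter> {\<delta>..}"
  have "closed P"
    unfolding P_def by (intro closed_Collect_eq continuous_curve continuous_on_const)
  then have "closed Q" unfolding Q_def by (intro closed_Int closed_atLeast)
  moreover have "T \<in> Q" using T \<delta>(2)[of T] by (simp add: Q_def P_def)
  moreover have below: "bdd_below Q" by (auto simp: Q_def intro: bdd_belowI[of _ \<delta>])
  ultimately have \<tau>Q: "Inf Q \<in> Q" using closed_contains_Inf[of Q] by blast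
  define \<tau> where "\<tau> = Inf Q"
  have \<tau>: "\<tau> > 0" "\<tau> \<in> P" using \<tau>Q \<delta>(1) by (auto simp: Q_def \<tau>_def)
  have mult: "\<gamma> (t + of_int n * \<tau>) = \<gamma> t" for n :: int and t
  proof (induction n arbitrary: t rule: int_induct[where k = 0])
    case (step1 n)
    then show ?case using period[OF \<tau>(2), of "t + of_int n * \<tau>"] by (simp add: algebra_simps)
  next
    case (step2 n)
    then show ?case using period[OF \<tau>(2), of "t + of_int (n - 1) * \<tau>"] by (simp add: algebra_simps)
  qed simp
  have multiple: "\<exists>n::int. r = of_int n * \<tau>" if r: "r \<in> P" for r
  proof -
    define n where "n = \<lfloor>r / \<tau>\<rfloor>"
    define q where "q = r - of_int n * \<tau>"
    have "of_int n \<le> r / \<tau>" "r / \<tau> < of_int n + 1" unfolding n_def by linarith+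
    then have q: "0 \<le> q" "q < \<tau>" using \<tau>(1) by (simp_all add: q_def field_simps)
    have "of_int n * \<tau> \<in> P" using mult[of 0 n] by (simp add: P_def)
    then have "q \<in> P" using diff r by (simp add: q_def)
    have "q = 0"
    proof (rule ccontr)
      assume "q \<noteq> 0"
      then have "q \<in> Q" using q \<open>q \<in> P\<close> \<delta>(2)[of q] by (simp add: Q_def)
      then show False using cInf_lower[OF _ below, of q] q by (simp add: \<tau>_def)
    qed
    then show ?thesis by (auto simp: q_def)
  qed
  have "\<gamma> s = \<gamma> t \<longleftrightarrow> (\<exists>n::int. s - t = of_int n * \<tau>)" for s t
  proof
    assume "\<gamma> s = \<gamma> t"
    then have "s - t \<in> P" using curve_meets_itself[of s t "- t"] by (simp add: P_def)
    then show "\<exists>n::int. s - t = of_int n * \<tau>" by (rule multiple)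
  next
    assume "\<exists>n::int. s - t = of_int n * \<tau>"
    then obtain n :: int where "s = t + of_int n * \<tau>" by (auto simp: algebra_simps)
    then show "\<gamma> s = \<gamma> t" using mult by simp
  qed
  then show ?thesis using that \<tau>(1) by blast
qed

end

locale closed_orbit = solution_curve A k X \<gamma>
  for A :: "('m::t2_space, 'n::finite) chart set" and k :: nat and X \<gamma> +
  fixes \<tau> :: real
  assumes period_pos: "\<tau> > 0" and period_iff: "\<gamma> s = \<gamma> t \<longleftrightarrow> (\<exists>n::int. s - t = of_int n * \<tau>)"
begin

lemma curve_period: "\<gamma> (t + of_int n * \<tau>) = \<gamma> t"
  unfolding period_iff by (intro exI[of _ n]) simp

lemma period_interval:
  obtains n :: int where "a \<le> t - of_int n * \<tau>" "t - of_int n * \<tau> < a + \<tau>"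
proof
  define n where "n = \<lfloor>(t - a) / \<tau>\<rfloor>"
  have "of_int n \<le> (t - a) / \<tau>" "(t - a) / \<tau> < of_int n + 1" unfolding n_def by linarith+
  then show "a \<le> t - of_int n * \<tau>" "t - of_int n * \<tau> < a + \<tau>"
    using period_pos by (simp_all add: field_simps)
qed

text \<open>
  A solution over one period that closes up descends to the orbit. Its translates by multiples of the
  period are solutions, and gluing two neighbouring ones gives a solution around the
  common end point.
\<close>
lemma periodic_adjoint_solution:
  assumes \<alpha>: "adjoint_solution_on {0..\<tau>} \<alpha>"
    and closes: "\<And>c. c \<in> A \<Longrightarrow> \<gamma> 0 \<in> cdom c \<Longrightarrow> \<alpha> c \<tau> = \<alpha> c 0"
  obtains \<omega> where "adjoint_solution_on UNIV (\<lambda>c t. \<omega> c (\<gamma> t))"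
    "\<And>c t. c \<in> A \<Longrightarrow> \<gamma> t \<in> cdom c \<Longrightarrow> t \<in> {0..\<tau>} \<Longrightarrow> \<omega> c (\<gamma> t) = \<alpha> c t"
proof -
  define \<omega> where "\<omega> = (\<lambda>c p. \<alpha> c (SOME t. t \<in> {0..<\<tau>} \<and> \<gamma> t = p))"
  have \<omega>: "\<omega> c (\<gamma> t) = \<alpha> c (t - of_int n * \<tau>)"
    if "c \<in> A" "\<gamma> t \<in> cdom c" "t - of_int n * \<tau> \<in> {0..\<tau>}" for c t n
  proof -
    define s where "s = t - of_int n * \<tau>"
    have \<gamma>s: "\<gamma> s = \<gamma> t" using curve_period[of s n] by (simp add: s_def)
    have uniq: "q = r" if qr: "q \<in> {0..<\<tau>}" "r \<in> {0..<\<tau>}" "\<gamma> q = \<gamma> r" for q r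
    proof -
      obtain m :: int where m: "q - r = of_int m * \<tau>" using qr(3) period_iff by blast
      have "\<bar>of_int m * \<tau>\<bar> < 1 * \<tau>" using qr unfolding m[symmetric] by auto
      then have "\<bar>m\<bar> < 1" using period_pos by (simp add: abs_mult flip: of_int_abs)
      then show ?thesis using m by simp
    qed
    show ?thesis
    proof (cases "s = \<tau>")
      case False
      then have s: "s \<in> {0..<\<tau>}" using that(3) by (auto simp: s_def)
      have "(SOME q. q \<in> {0..<\<tau>} \<and> \<gamma> q = \<gamma> t) = s"
        using uniq s \<gamma>s by (intro some_equality) auto
      then show ?thesis by (simp add: \<omega>_def s_def)
    next
      case True
      have \<gamma>0: "\<gamma> 0 = \<gamma> t" using curve_period[of 0 1] \<gamma>s True by simp
      have "(SOME q. q \<in> {0..<\<tau>} \<and> \<gamma> q = \<gamma> t) = 0"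
        using uniq[of _ 0] \<gamma>0 period_pos by (intro some_equality) auto
      then show ?thesis using closes[OF that(1)] that(2) \<gamma>0 True by (simp add: \<omega>_def s_def)
    qed
  qed
  have one: "adjoint_solution_on {of_int n * \<tau>..of_int (n + 1) * \<tau>} (\<lambda>c t. \<omega> c (\<gamma> t))" for n :: int
  proof (rule adjoint_solution_on_cong)
    have "adjoint_solution_on {0 + of_int n * \<tau>..\<tau> + of_int n * \<tau>} (\<lambda>c t. \<alpha> c (t - of_int n * \<tau>))"
      by (rule adjoint_solution_on_shift[OF \<alpha> curve_period])
    then show "adjoint_solution_on {of_int n * \<tau>..of_int (n + 1) * \<tau>} (\<lambda>c t. \<alpha> c (t - of_int n * \<tau>))"
      by (simp add: algebra_simps)
    fix c t assume "c \<in> A" "t \<in> {of_int n * \<tau>..of_int (n + 1) * \<tau>}" "\<gamma> t \<in> cdom c"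
    then show "\<alpha> c (t - of_int n * \<tau>) = \<omega> c (\<gamma> t)"
      using \<omega>[of c t n] by (simp add: algebra_simps)
  qed
  have two: "adjoint_solution_on {of_int (n - 1) * \<tau>..of_int (n + 1) * \<tau>} (\<lambda>c t. \<omega> c (\<gamma> t))" for n :: int
    using adjoint_solution_on_glue[OF _ _ one[of "n - 1", simplified] one[of n]] period_pos
    by (simp add: algebra_simps)
  have "adjoint_solution_on UNIV (\<lambda>c t. \<omega> c (\<gamma> t))"
    unfolding adjoint_solution_on_def
  proof (intro ballI conjI impI)
    fix t :: real
    obtain n :: int where n: "0 \<le> t - of_int n * \<tau>" "t - of_int n * \<tau> < 0 + \<tau>"
      by (rule period_interval)
    have int: "t \<in> interior {of_int (n - 1) * \<tau>..of_int (n + 1) * \<tau>}"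
      using n period_pos by (simp add: interior_atLeastAtMost_real algebra_simps)
    then have t: "t \<in> {of_int (n - 1) * \<tau>..of_int (n + 1) * \<tau>}" using interior_subset by blast
    show "covector (\<gamma> t) (\<lambda>c. \<omega> c (\<gamma> t))" by (rule adjoint_solution_covector[OF two t])
    fix c assume c: "c \<in> A" "\<gamma> t \<in> cdom c"
    show "((\<lambda>t. \<omega> c (\<gamma> t)) has_vector_derivative - adjoint (dfield X c (\<gamma> t)) (\<omega> c (\<gamma> t))) (at t within UNIV)"
      using adjoint_solution_derivative[OF two t c] unfolding at_within_interior[OF int] by simp
  qed
  moreover have "\<omega> c (\<gamma> t) = \<alpha> c t" if "c \<in> A" "\<gamma> t \<in> cdom c" "t \<in> {0..\<tau>}" for c t
    using \<omega>[of c t 0] that by simp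
  ultimately show ?thesis using that by blast
qed

end

section \<open>From periodic transport to sections satisfying the adjoint variational equation\<close>

context closed_orbit
begin

text \<open>
  Time along the orbit, as a \<open>C\<^sup>1\<close> function \<open>\<theta>\<close> of the coordinates near \<open>\<gamma> t\<^sub>0\<close>. With \<open>w\<close> the velocity at
  \<open>t\<^sub>0\<close>, the function \<open>g t = cmap c (\<gamma> t) \<bullet> w\<close> has positive derivative near \<open>t\<^sub>0\<close>, and \<open>\<theta> x\<close> is the inverse of
  \<open>g\<close> at \<open>x \<bullet> w\<close>. The rest of the orbit could meet the domain of \<open>\<theta>\<close> at other times; it is a compact
  set that avoids \<open>\<gamma> t\<^sub>0\<close>, because \<open>\<tau>\<close> is the minimal period, and it is removed from \<open>U\<close>.
\<close>
lemma local_time_function: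
  assumes nz: "c \<in> A" "\<gamma> t\<^sub>0 \<in> cdom c" "X c (\<gamma> t\<^sub>0) \<noteq> 0"
  obtains U \<theta> \<theta>' where "open U" "\<gamma> t\<^sub>0 \<in> U" "U \<subseteq> cdom c"
    "\<And>x. x \<in> cmap c ` U \<Longrightarrow> (\<theta> has_derivative (\<lambda>u. u \<bullet> \<theta>' x)) (at x)"
    "continuous_on (cmap c ` U) \<theta>'"
    "\<And>x. x \<in> cmap c ` U \<Longrightarrow> \<gamma> (\<theta> x) \<in> cdom c"
    "\<And>t. \<gamma> t \<in> U \<Longrightarrow> \<gamma> (\<theta> (cmap c (\<gamma> t))) = \<gamma> t"
proof -
  define w where "w = X c (\<gamma> t\<^sub>0)"
  define W where "W = {p \<in> cdom c. X c p \<bullet> w > 0}"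
  have "continuous_on (cdom c) (\<lambda>p. X c p \<bullet> w)"
    using continuous_on_field[OF nz(1) open_UNIV C1] by (intro continuous_intros) simp
  then have "open (cdom c \<inter> (\<lambda>p. X c p \<bullet> w) -` {0<..})"
    by (rule continuous_open_preimage[OF _ open_cdom[OF nz(1)] open_greaterThan])
  moreover have "cdom c \<inter> (\<lambda>p. X c p \<bullet> w) -` {0<..} = W" by (auto simp: W_def)
  ultimately have "open W" by simp
  moreover have "\<gamma> t\<^sub>0 \<in> W" using nz by (simp add: W_def w_def)
  ultimately obtain d where d: "d > 0" "\<And>s. \<bar>s - t\<^sub>0\<bar> < d \<Longrightarrow> \<gamma> s \<in> W"
    by (rule curve_near) (rule that)
  \<comment> \<open>With \<open>2 * \<delta> < \<tau>\<close> the arc around \<open>t\<^sub>0\<close> is disjoint from its translates by the period.\<close>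
  define \<delta> where "\<delta> = min (d / 2) (\<tau> / 3)"
  have \<delta>: "\<delta> > 0" "\<delta> < d" "2 * \<delta> < \<tau>" using d period_pos by (auto simp: \<delta>_def)
  define J where "J = {t\<^sub>0 - \<delta>..t\<^sub>0 + \<delta>}"
  have inW: "\<gamma> s \<in> cdom c" "X c (\<gamma> s) \<bullet> w > 0" if "s \<in> J" for s
    using d(2)[of s] that \<delta> by (auto simp: J_def W_def)
  define g where "g = (\<lambda>t. cmap c (\<gamma> t) \<bullet> w)"
  have g': "(g has_real_derivative X c (\<gamma> s) \<bullet> w) (at s)" if "s \<in> J" for s
    unfolding g_def by (rule curve_component_derivative[OF nz(1) inW(1)[OF that]])
  have mono: "g r < g s" if "r \<in> J" "s \<in> J" "r < s" for r s
  proof (rule DERIV_pos_imp_increasing[OF that(3)])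
    fix x assume "r \<le> x" "x \<le> s"
    then have "x \<in> J" using that by (auto simp: J_def)
    then show "\<exists>y. (g has_real_derivative y) (at x) \<and> 0 < y" using g' inW by blast
  qed
  have inj: "inj_on g J"
    by (rule linorder_inj_onI) (use mono in \<open>auto simp: J_def, force\<close>)
  have gcont: "continuous_on J g"
    using g' DERIV_isCont by (intro continuous_at_imp_continuous_on) blast
  define \<sigma> where "\<sigma> = inv_into J g"
  have \<sigma>g: "\<sigma> (g s) = s" if "s \<in> J" for s
    unfolding \<sigma>_def by (rule inv_into_f_f[OF inj that])
  have \<sigma>cont: "continuous_on (g ` J) \<sigma>"
    unfolding \<sigma>_def by (rule continuous_on_inv[OF gcont]) (use inj in \<open>simp_all add: J_def\<close>)
  define l u where "l = g (t\<^sub>0 - \<delta>)" and "u = g (t\<^sub>0 + \<delta>)"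
  have surj: "\<exists>s\<in>J. g s = y" if "l < y" "y < u" for y
    using IVT'[of g "t\<^sub>0 - \<delta>" y "t\<^sub>0 + \<delta>"] that gcont \<delta> by (auto simp: l_def u_def J_def)
  have \<sigma>J: "\<sigma> y \<in> J" and g\<sigma>: "g (\<sigma> y) = y" if "l < y" "y < u" for y
    using surj[OF that] \<sigma>g by auto
  have \<sigma>': "(\<sigma> has_real_derivative inverse (X c (\<gamma> (\<sigma> y)) \<bullet> w)) (at y)" if y: "l < y" "y < u" for y
  proof (rule DERIV_inverse_function[OF g'[OF \<sigma>J[OF y]] _ y g\<sigma>])
    show "X c (\<gamma> (\<sigma> y)) \<bullet> w \<noteq> 0" using inW(2)[OF \<sigma>J[OF y]] by simp
    have "{l<..<u} \<subseteq> g ` J" using surj by force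
    then have "continuous_on {l<..<u} \<sigma>" by (rule continuous_on_subset[OF \<sigma>cont])
    then show "isCont \<sigma> y" using y by (simp add: continuous_on_eq_continuous_at)
  qed
  define K where "K = \<gamma> ` {t\<^sub>0 + \<delta>..t\<^sub>0 + \<tau> - \<delta>}"
  have "closed K"
    unfolding K_def by (intro compact_imp_closed compact_continuous_image continuous_curve) simp
  define U where "U = (cdom c \<inter> (\<lambda>p. cmap c p \<bullet> w) -` {l<..<u}) - K"
  define \<theta> where "\<theta> = (\<lambda>x. \<sigma> (x \<bullet> w))"
  define \<theta>' where "\<theta>' = (\<lambda>x. inverse (X c (\<gamma> (\<theta> x)) \<bullet> w) *\<^sub>R w)"
  have bounds: "l < x \<bullet> w" "x \<bullet> w < u" if "x \<in> cmap c ` U" for x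
    using that by (auto simp: U_def)
  have \<theta>J: "\<theta> x \<in> J" if "x \<in> cmap c ` U" for x
    unfolding \<theta>_def by (rule \<sigma>J[OF bounds[OF that]])
  have D: "(\<theta> has_derivative (\<lambda>u. u \<bullet> \<theta>' x)) (at x)" if "x \<in> cmap c ` U" for x
  proof -
    have "((\<lambda>x. x \<bullet> w) has_derivative (\<lambda>u. u \<bullet> w)) (at x)" by (auto intro!: derivative_eq_intros)
    from has_derivative_compose[OF this \<sigma>'[OF bounds[OF that], unfolded has_field_derivative_def]]
    show ?thesis by (simp add: \<theta>_def \<theta>'_def mult.commute)
  qed
  show ?thesis
  proof (rule that[OF _ _ _ D])
    show "open U"
      unfolding U_def
      by (intro open_Diff continuous_open_preimage continuous_on_inner continuous_on_cmap continuous_on_const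
          open_cdom open_greaterThanLessThan nz \<open>closed K\<close>)
    show "U \<subseteq> cdom c" by (auto simp: U_def)
    have "\<gamma> t\<^sub>0 \<notin> K"
    proof
      assume "\<gamma> t\<^sub>0 \<in> K"
      then obtain s where s: "t\<^sub>0 + \<delta> \<le> s" "s \<le> t\<^sub>0 + \<tau> - \<delta>" "\<gamma> s = \<gamma> t\<^sub>0"
        unfolding K_def by auto
      then obtain n :: int where n: "s - t\<^sub>0 = of_int n * \<tau>" using period_iff by blast
      have "0 * \<tau> < of_int n * \<tau>" "of_int n * \<tau> < 1 * \<tau>" using s \<delta> unfolding n[symmetric] by auto
      then show False using period_pos by (simp add: zero_less_mult_iff)
    qed
    moreover have "l < g t\<^sub>0" "g t\<^sub>0 < u" unfolding l_def u_def by (intro mono; use \<delta> in \<open>simp add: J_def\<close>)+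
    ultimately show "\<gamma> t\<^sub>0 \<in> U" using nz by (simp add: U_def g_def)
    show "\<gamma> (\<theta> x) \<in> cdom c" if "x \<in> cmap c ` U" for x by (rule inW(1)[OF \<theta>J[OF that]])
    have \<theta>cont: "continuous_on (cmap c ` U) \<theta>"
      using D has_derivative_continuous by (intro continuous_at_imp_continuous_on) blast
    have "continuous_on J (\<lambda>s. X c (\<gamma> s) \<bullet> w)"
      by (rule continuous_on_inner[OF continuous_on_compose2[OF continuous_on_field[OF nz(1) open_UNIV C1] continuous_curve]])
        (use inW in auto)
    then have "continuous_on (cmap c ` U) (\<lambda>x. X c (\<gamma> (\<theta> x)) \<bullet> w)"
      by (rule continuous_on_compose2[OF _ \<theta>cont]) (use \<theta>J in blast)
    moreover have "X c (\<gamma> (\<theta> x)) \<bullet> w \<noteq> 0" if "x \<in> cmap c ` U" for x using inW(2)[OF \<theta>J[OF that]] by simp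
    ultimately show "continuous_on (cmap c ` U) \<theta>'"
      unfolding \<theta>'_def by (intro continuous_on_scaleR continuous_on_inverse continuous_on_const) blast+
    fix t assume t: "\<gamma> t \<in> U"
    \<comment> \<open>A point of the orbit in \<open>U\<close> is visited at a time of the short arc, since the rest of the orbit is \<open>K\<close>.\<close>
    obtain n :: int where n: "t\<^sub>0 - \<delta> \<le> t - of_int n * \<tau>" "t - of_int n * \<tau> < t\<^sub>0 - \<delta> + \<tau>"
      by (rule period_interval)
    define s where "s = t - of_int n * \<tau>"
    have s: "\<gamma> s = \<gamma> t" using curve_period[of s n] by (simp add: s_def)
    have "\<gamma> s \<notin> K" using t s by (simp add: U_def)
    then have "s \<notin> {t\<^sub>0 + \<delta>..t\<^sub>0 + \<tau> - \<delta>}" unfolding K_def by blast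
    then have "s \<in> J" using n by (auto simp: J_def s_def)
    then have "\<theta> (cmap c (\<gamma> s)) = s" using \<sigma>g by (simp add: \<theta>_def g_def)
    then show "\<gamma> (\<theta> (cmap c (\<gamma> t))) = \<gamma> t" using s by simp
  qed
qed

context
  fixes \<omega>
  assumes \<omega>: "adjoint_solution_on UNIV (\<lambda>c t. \<omega> c (\<gamma> t))"
begin

lemma section_covector: "covector (\<gamma> t) (\<lambda>c. \<omega> c (\<gamma> t))"
  by (rule adjoint_solution_covector[OF \<omega> UNIV_I])

lemma section_derivative:
  "c \<in> A \<Longrightarrow> \<gamma> t \<in> cdom c \<Longrightarrow>
    ((\<lambda>t. \<omega> c (\<gamma> t)) has_vector_derivative - adjoint (dfield X c (\<gamma> t)) (\<omega> c (\<gamma> t))) (at t)"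
  using adjoint_solution_derivative[OF \<omega> UNIV_I] .

lemma
  assumes c: "c \<in> A" and I: "\<And>t. t \<in> I \<Longrightarrow> \<gamma> t \<in> cdom c"
  shows continuous_on_section: "continuous_on I (\<lambda>t. \<omega> c (\<gamma> t))"
    and continuous_on_section_derivative:
      "continuous_on I (\<lambda>t. - adjoint (dfield X c (\<gamma> t)) (\<omega> c (\<gamma> t)))"
proof -
  show *: "continuous_on I (\<lambda>t. \<omega> c (\<gamma> t))"
    by (rule has_vector_derivative_imp_continuous_on[OF has_vector_derivative_at_within[OF section_derivative[OF c I]]])
  show "continuous_on I (\<lambda>t. - adjoint (dfield X c (\<gamma> t)) (\<omega> c (\<gamma> t)))"
    by (rule continuous_on_minus[OF continuous_on_adjoint_apply[OF linear_dfield_curve[OF c I]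
            continuous_on_dfield_curve[OF c I] *]])
qed

lemma C1_section: "C1_section A \<gamma> \<omega>"
  unfolding C1_section_def One_nat_def
proof (intro conjI ballI)
  show "one_form_on A (range \<gamma>) \<omega>"
    unfolding one_form_on_def
  proof (intro ballI)
    fix c c' p assume c: "c \<in> A" "c' \<in> A" and p: "p \<in> cdom c \<inter> cdom c' \<inter> range \<gamma>"
    then obtain t where "p = \<gamma> t" by blast
    then show "\<omega> c p = adjoint (dtransition c c' p) (\<omega> c' p)"
      using covectorD[OF section_covector c, of t] p by blast
  qed
  fix c assume c: "c \<in> A"
  show "Ck (Suc 0) (\<lambda>t. \<omega> c (\<gamma> t)) {t. \<gamma> t \<in> cdom c}"
  proof (rule Ck_SucI)
    show "((\<lambda>t. \<omega> c (\<gamma> t)) has_derivative (\<lambda>h. h *\<^sub>R - adjoint (dfield X c (\<gamma> t)) (\<omega> c (\<gamma> t))))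
        (at t within {t. \<gamma> t \<in> cdom c})" if "t \<in> {t. \<gamma> t \<in> cdom c}" for t
      by (rule has_derivative_at_withinI[OF section_derivative[OF c, unfolded has_vector_derivative_def]])
        (use that in simp)
    have "continuous_on {t. \<gamma> t \<in> cdom c} (\<lambda>t. - adjoint (dfield X c (\<gamma> t)) (\<omega> c (\<gamma> t)))"
      by (rule continuous_on_section_derivative[OF c]) simp
    then show "Ck 0 (\<lambda>t. h *\<^sub>R - adjoint (dfield X c (\<gamma> t)) (\<omega> c (\<gamma> t))) {t. \<gamma> t \<in> cdom c}" for h
      unfolding Ck.simps(1) by (rule continuous_on_scaleR[OF continuous_on_const])
  qed
qed

text \<open>
  In the Lie derivative of an extension only the derivative in the direction of \<open>X\<close> occurs. On the
  orbit this is the derivative of \<open>\<omega>\<close> with respect to time, which the equation prescribes.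
\<close>
lemma lie_derivative_of_extension:
  assumes ext: "C1_extension A \<gamma> \<omega> U \<omega>'" and c: "c \<in> A" and p: "p \<in> cdom c \<inter> U \<inter> range \<gamma>"
  shows "lie_derivative_form X \<omega>' c p = 0"
proof -
  obtain t where t: "p = \<gamma> t" using p by blast
  have U: "open U" and \<omega>'C1: "Ck_field_on A 1 U \<omega>'"
    and eq: "\<And>q. q \<in> cdom c \<inter> U \<inter> range \<gamma> \<Longrightarrow> \<omega>' c q = \<omega> c q"
    using ext c unfolding C1_extension_def by blast+
  have pU: "\<gamma> t \<in> cdom c \<inter> U" and tc: "\<gamma> t \<in> cdom c" using p t by auto
  obtain d where d: "d > 0" "\<And>s. \<bar>s - t\<bar> < d \<Longrightarrow> \<gamma> s \<in> cdom c \<inter> U"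
    by (rule curve_near[OF open_Int[OF open_cdom[OF c] U] pU]) (rule that)
  have "((\<lambda>s. cmap c (\<gamma> s)) has_derivative (\<lambda>h. h *\<^sub>R X c (\<gamma> t))) (at t)"
    using curve_has_derivative[OF c tc] by (simp add: has_vector_derivative_def)
  from has_derivative_compose[OF this has_derivative_local_rep[OF c U \<omega>'C1 pU]]
  have "((\<lambda>s. local_rep \<omega>' c (cmap c (\<gamma> s))) has_vector_derivative dfield \<omega>' c (\<gamma> t) (X c (\<gamma> t))) (at t)"
    by (simp add: has_vector_derivative_def linear_scale[OF linear_dfield[OF c U \<omega>'C1 pU]])
  moreover have "((\<lambda>s. local_rep \<omega>' c (cmap c (\<gamma> s))) has_vector_derivative
      - adjoint (dfield X c (\<gamma> t)) (\<omega> c (\<gamma> t))) (at t)"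
    unfolding has_vector_derivative_def
  proof (rule has_derivative_transform_within[OF section_derivative[OF c tc, unfolded has_vector_derivative_def] d(1)])
    fix s assume "dist s t < d"
    then have "\<gamma> s \<in> cdom c \<inter> U" using d(2) by (simp add: dist_real_def)
    then show "\<omega> c (\<gamma> s) = local_rep \<omega>' c (cmap c (\<gamma> s))"
      using eq local_rep_cmap[OF c] by simp
  qed simp
  ultimately have "dfield \<omega>' c (\<gamma> t) (X c (\<gamma> t)) = - adjoint (dfield X c (\<gamma> t)) (\<omega> c (\<gamma> t))"
    by (rule vector_derivative_unique_at)
  moreover have "\<omega>' c (\<gamma> t) = \<omega> c (\<gamma> t)" using eq pU by simp
  ultimately show ?thesis unfolding lie_derivative_form_def t by simp
qed

text \<open>
  The extension is constant, in one chart, on the level sets of the time function \<open>\<theta>\<close>, and is carried to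
  the other charts as a 1-form. It is of class \<open>C\<^sup>1\<close> because the solution has a continuous derivative and
  the Jacobians of the coordinate changes are \<open>C\<^sup>1\<close>.
\<close>
lemma local_extension_exists:
  assumes c: "c \<in> A" "\<gamma> t\<^sub>0 \<in> cdom c" "X c (\<gamma> t\<^sub>0) \<noteq> 0"
  obtains U \<omega>' where "\<gamma> t\<^sub>0 \<in> U" "C1_extension A \<gamma> \<omega> U \<omega>'"
proof -
  obtain U \<theta> \<theta>' where U: "open U" "\<gamma> t\<^sub>0 \<in> U" "U \<subseteq> cdom c"
    and \<theta>: "\<And>x. x \<in> cmap c ` U \<Longrightarrow> (\<theta> has_derivative (\<lambda>u. u \<bullet> \<theta>' x)) (at x)"
      "continuous_on (cmap c ` U) \<theta>'"
      "\<And>x. x \<in> cmap c ` U \<Longrightarrow> \<gamma> (\<theta> x) \<in> cdom c"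
      "\<And>t. \<gamma> t \<in> U \<Longrightarrow> \<gamma> (\<theta> (cmap c (\<gamma> t))) = \<gamma> t"
    by (rule local_time_function[OF c]) (rule that)
  define \<eta> where "\<eta> = (\<lambda>t. \<omega> c (\<gamma> t))"
  define \<eta>' where "\<eta>' = (\<lambda>t. - adjoint (dfield X c (\<gamma> t)) (\<omega> c (\<gamma> t)))"
  define \<omega>' where "\<omega>' = (\<lambda>c' q. adjoint (dtransition c' c q) (\<eta> (\<theta> (cmap c q))))"
  have "C1_extension A \<gamma> \<omega> U \<omega>'"
    unfolding C1_extension_def
  proof (intro conjI ballI)
    show "open U" by (rule U)
    show "one_form_on A U \<omega>'"
      unfolding one_form_on_def
    proof (intro ballI)
      fix c' c'' q assume "c' \<in> A" "c'' \<in> A" "q \<in> cdom c' \<inter> cdom c'' \<inter> U"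
      then show "\<omega>' c' q = adjoint (dtransition c' c'' q) (\<omega>' c'' q)"
        unfolding \<omega>'_def using adjoint_dtransition_compose[OF _ _ c(1)] U(3) by blast
    qed
    fix c' p assume c': "c' \<in> A" and p: "p \<in> cdom c' \<inter> U \<inter> range \<gamma>"
    then obtain t where t: "p = \<gamma> t" "\<gamma> t \<in> U" "\<gamma> t \<in> cdom c'" by auto
    then have "\<omega>' c' p = adjoint (dtransition c' c (\<gamma> t)) (\<omega> c (\<gamma> t))"
      using \<theta>(4)[OF t(2)] by (simp add: \<omega>'_def \<eta>_def)
    also have "\<dots> = \<omega> c' p"
      using covectorD[OF section_covector c' c(1) t(3)] t U(3) by auto
    finally show "\<omega>' c' p = \<omega> c' p" .
  next
    show "Ck_field_on A 1 U \<omega>'"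
      unfolding Ck_field_on_def One_nat_def
    proof
      fix c' assume c': "c' \<in> A"
      define S where "S = cmap c' ` (cdom c' \<inter> U)"
      define \<phi> where "\<phi> = transition c' c"
      define D where "D = (\<lambda>x. frechet_derivative \<phi> (at x))"
      define D2 where "D2 = (\<lambda>b x. frechet_derivative (\<lambda>y. D y b) (at x))"
      have S: "open S" unfolding S_def by (rule open_cmap_image[OF c' U(1)])
      have Ssub: "S \<subseteq> cmap c' ` (cdom c' \<inter> cdom c)" using U(3) by (auto simp: S_def)
      have \<phi>S: "\<phi> x \<in> cmap c ` U" if "x \<in> S" for x
        using that transition_cmap[OF c' c(1)] by (auto simp: S_def \<phi>_def)
      note op = open_overlap[OF c' c(1)]
      note Ck2 = Ck_transition[OF c' c(1), folded \<phi>_def]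
      have d\<phi>: "(\<phi> has_derivative D x) (at x)" if "x \<in> S" for x
        unfolding D_def by (rule Ck_Suc_has_derivative[OF op Ck2]) (use that Ssub in blast)
      have linD: "linear (D x)" if "x \<in> S" for x
        by (rule has_derivative_linear[OF d\<phi>[OF that]])
      have dD: "((\<lambda>y. D y b) has_derivative D2 b x) (at x)" if "x \<in> S" for b x
        unfolding D2_def D_def
        by (rule Ck_Suc_has_derivative[OF op Ck_Suc_frechet_derivative[OF op Ck2]]) (use that Ssub in blast)
      have Dcont: "continuous_on S (\<lambda>x. D x b)" for b
        unfolding D_def
        by (rule continuous_on_subset[OF Ck_imp_continuous_on[OF Ck_Suc_frechet_derivative[OF op Ck2]] Ssub])
      have D2cont: "continuous_on S (\<lambda>x. D2 b x u)" for b u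
        unfolding D2_def D_def \<phi>_def
        by (rule continuous_on_subset[OF continuous_on_second_derivative_transition[OF c' c(1)] Ssub])
      have \<phi>cont: "continuous_on S \<phi>"
        by (rule continuous_on_subset[OF Ck_imp_continuous_on[OF Ck2] Ssub])
      define s where "s = (\<lambda>x. \<theta> (\<phi> x))"
      have s': "(s has_derivative (\<lambda>u. D x u \<bullet> \<theta>' (\<phi> x))) (at x)" if "x \<in> S" for x
        unfolding s_def by (rule has_derivative_compose[OF d\<phi>[OF that] \<theta>(1)[OF \<phi>S[OF that]]])
      have sc: "\<gamma> (s x) \<in> cdom c" if "x \<in> S" for x
        unfolding s_def by (rule \<theta>(3)[OF \<phi>S[OF that]])
      have scont: "continuous_on S s"
        using s' has_derivative_continuous by (intro continuous_at_imp_continuous_on) blast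
      have \<theta>'cont: "continuous_on S (\<lambda>x. \<theta>' (\<phi> x))"
        by (rule continuous_on_compose2[OF \<theta>(2) \<phi>cont]) (use \<phi>S in blast)
      have \<eta>cont: "continuous_on S (\<lambda>x. \<eta> (s x))"
        unfolding \<eta>_def
        by (rule continuous_on_compose2[OF continuous_on_section[OF c(1), of "s ` S"] scont]) (use sc in auto)
      have \<eta>'cont: "continuous_on S (\<lambda>x. \<eta>' (s x))"
        unfolding \<eta>'_def
        by (rule continuous_on_compose2[OF continuous_on_section_derivative[OF c(1), of "s ` S"] scont])
          (use sc in auto)
      have d\<eta>: "((\<lambda>x. \<eta> (s x)) has_derivative (\<lambda>u. (D x u \<bullet> \<theta>' (\<phi> x)) *\<^sub>R \<eta>' (s x))) (at x)"
        if "x \<in> S" for x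
        unfolding \<eta>_def \<eta>'_def
        by (rule has_derivative_compose[OF s'[OF that]
              section_derivative[OF c(1) sc[OF that], unfolded has_vector_derivative_def]])
      \<comment> \<open>In coordinates the adjoint is a finite sum, which can be differentiated term by term.\<close>
      have rep: "(\<Sum>b\<in>Basis. (D x b \<bullet> \<eta> (s x)) *\<^sub>R b) = local_rep \<omega>' c' x" if "x \<in> S" for x
      proof -
        obtain q where q: "q \<in> cdom c'" "q \<in> U" "x = cmap c' q"
          using \<open>x \<in> S\<close> by (auto simp: S_def)
        have "local_rep \<omega>' c' x = adjoint (D x) (\<eta> (s x))"
          using q by (simp add: local_rep_cmap[OF c'] \<omega>'_def dtransition_def D_def \<phi>_def s_def
              transition_cmap[OF c' c(1)])
        then show ?thesis using adjoint_eq_sum_Basis[OF linD[OF that]] by simp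
      qed
      have "Ck (Suc 0) (\<lambda>x. \<Sum>b\<in>Basis. (D x b \<bullet> \<eta> (s x)) *\<^sub>R b) S"
      proof (rule Ck_SucI)
        fix x assume x: "x \<in> S"
        show "((\<lambda>x. \<Sum>b\<in>Basis. (D x b \<bullet> \<eta> (s x)) *\<^sub>R b) has_derivative
            (\<lambda>u. \<Sum>b\<in>Basis. (D x b \<bullet> ((D x u \<bullet> \<theta>' (\<phi> x)) *\<^sub>R \<eta>' (s x)) + D2 b x u \<bullet> \<eta> (s x)) *\<^sub>R b))
            (at x within S)"
          by (intro has_derivative_sum has_derivative_scaleR_left
              has_derivative_inner[OF has_derivative_at_withinI[OF dD[OF x]] has_derivative_at_withinI[OF d\<eta>[OF x]]])
      next
        show "Ck 0 (\<lambda>x. \<Sum>b\<in>Basis. (D x b \<bullet> ((D x u \<bullet> \<theta>' (\<phi> x)) *\<^sub>R \<eta>' (s x)) + D2 b x u \<bullet> \<eta> (s x)) *\<^sub>R b) S" for u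
          unfolding Ck.simps(1)
          by (intro continuous_intros Dcont D2cont \<theta>'cont \<eta>cont \<eta>'cont)
      qed
      then show "Ck (Suc 0) (local_rep \<omega>' c') (cmap c' ` (cdom c' \<inter> U))"
        unfolding S_def[symmetric] by (rule Ck_cong[rotated]) (rule rep)
    qed
  qed
  then show ?thesis using that U(2) by blast
qed

lemma satisfies_AVE:
  assumes nz: "\<And>c t. c \<in> A \<Longrightarrow> \<gamma> t \<in> cdom c \<Longrightarrow> X c (\<gamma> t) \<noteq> 0"
  shows "satisfies_AVE A X \<gamma> \<omega>"
  unfolding satisfies_AVE_def
proof (intro conjI ballI allI impI)
  show "C1_section A \<gamma> \<omega>" by (rule C1_section)
  show "\<exists>U \<omega>'. p \<in> U \<and> C1_extension A \<gamma> \<omega> U \<omega>'" if p: "p \<in> range \<gamma>" for p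
  proof -
    obtain t where t: "p = \<gamma> t" using p by blast
    obtain c where c: "c \<in> A" "\<gamma> t \<in> cdom c" using chart_at .
    show ?thesis using local_extension_exists[OF c nz[OF c]] unfolding t by metis
  qed
  show "lie_derivative_form X \<omega>' c p = 0"
    if "C1_extension A \<gamma> \<omega> U \<omega>'" "c \<in> A" "p \<in> cdom c \<inter> U \<inter> range \<gamma>" for U \<omega>' c p
    using lie_derivative_of_extension that .
qed

end

end

section \<open>Monodromy and the choice of the section\<close>

text \<open>
  The image of \<open>L\<close> is orthogonal to a plane, so the kernel of \<open>L\<close> is at least two-dimensional and meets
  the kernel of the functional \<open>J\<close>. The argument avoids counting: \<open>v \<mapsto> L v + J v *\<^sub>R x\<close> is not surjective,
  since its image is orthogonal to the component of \<open>z\<close> perpendicular to \<open>x\<close>. Hence some nonzero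
  \<open>v\<close> satisfies \<open>L v + J v *\<^sub>R x = 0\<close>, and both summands vanish because they are orthogonal.
\<close>
lemma common_kernel_vector:
  fixes L :: "'a::euclidean_space \<Rightarrow> 'a" and J :: "'a \<Rightarrow> real"
  assumes lin: "linear L" "linear J"
    and orth: "\<And>v. L v \<bullet> x = 0" "\<And>v. L v \<bullet> z = 0"
    and indep: "\<And>a b. a *\<^sub>R x + b *\<^sub>R z = 0 \<Longrightarrow> a = 0 \<and> b = 0"
  obtains v where "v \<noteq> 0" "L v = 0" "J v = 0"
proof -
  define f where "f = (\<lambda>v. L v + J v *\<^sub>R x)"
  have linf: "linear f"
    unfolding f_def
    by (intro linear_compose_add lin(1) linearI)
      (simp_all add: linear_add[OF lin(2)] linear_scale[OF lin(2)] algebra_simps)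
  have x: "x \<bullet> x \<noteq> 0" using indep[of 1 0] by auto
  define y where "y = (- (x \<bullet> z)) *\<^sub>R x + (x \<bullet> x) *\<^sub>R z"
  have "y \<noteq> 0" using indep[of "- (x \<bullet> z)" "x \<bullet> x"] x by (auto simp: y_def)
  have "f v \<bullet> y = 0" for v
    by (simp add: f_def y_def inner_add_left inner_diff_left inner_add_right inner_diff_right orth)
  then have "y \<noteq> f v" for v using \<open>y \<noteq> 0\<close> by (metis inner_eq_zero_iff)
  then have "\<not> surj f" unfolding surj_def by blast
  then have "\<not> inj f" using linear_injective_imp_surjective[OF linf] by blast
  then obtain v where v: "v \<noteq> 0" "f v = 0" unfolding linear_injective_0[OF linf] by blast
  have "J v * (x \<bullet> x) = f v \<bullet> x" by (simp add: f_def inner_add_left orth)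
  then have "J v = 0" using v x by simp
  then show ?thesis using that[of v] v by (simp add: f_def)
qed

lemma has_integral_periods:
  fixes g :: "real \<Rightarrow> 'a::banach"
  assumes "\<tau> > 0" and period: "\<And>t n. g (t + of_nat n * \<tau>) = g t" and g: "(g has_integral i) {0..\<tau>}"
  shows "(g has_integral of_nat n *\<^sub>R i) {0..of_nat n * \<tau>}"
proof (induction n)
  case (Suc n)
  have "((\<lambda>t. g (1 *\<^sub>R t + - (of_nat n * \<tau>))) has_integral i) {of_nat n * \<tau>..of_nat (Suc n) * \<tau>}"
    using has_integral_affinity[of g i 0 \<tau> 1 "- (of_nat n * \<tau>)"] g
    by (simp add: algebra_simps)
  moreover have "g (1 *\<^sub>R t + - (of_nat n * \<tau>)) = g t" for t
    using period[of "t - of_nat n * \<tau>" n] by simp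
  ultimately have "(g has_integral i) {of_nat n * \<tau>..of_nat (Suc n) * \<tau>}" by simp
  from has_integral_combine[OF _ _ Suc.IH this] show ?case
    using assms(1) by (simp add: algebra_simps)
qed (simp add: has_integral_refl)

context closed_orbit
begin

text \<open>
  Here \<open>L\<close> is the monodromy minus the identity, in the coordinates of a chart around \<open>\<gamma> 0\<close>, and \<open>J\<close> is the
  integral over one period as a functional of the initial covector. The kernel of \<open>L\<close> consists of
  the covectors whose transport closes up.
\<close>
lemma AVE_section_in_kernel:
  assumes U: "open U" "range \<gamma> \<subseteq> U"
    and Z: "vector_field_on A U Z" "Ck_field_on A 1 U Z"
    and comm: "\<And>c p. c \<in> A \<Longrightarrow> p \<in> cdom c \<inter> U \<Longrightarrow> lie_bracket X Z c p = 0"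
    and indep: "\<And>c p a b. c \<in> A \<Longrightarrow> p \<in> cdom c \<inter> U \<Longrightarrow> a *\<^sub>R X c p + b *\<^sub>R Z c p = 0 \<Longrightarrow> a = 0 \<and> b = 0"
    and Y: "vector_field_on A U Y" "\<And>c. c \<in> A \<Longrightarrow> continuous_on (cdom c \<inter> U) (Y c)"
  obtains \<omega> c where "satisfies_AVE A X \<gamma> \<omega>" "c \<in> A" "\<gamma> 0 \<in> cdom c" "\<omega> c (\<gamma> 0) \<noteq> 0"
    "((\<lambda>t. form_apply A \<omega> Y (\<gamma> t)) has_integral 0) {0..\<tau>}"
proof -
  obtain c where c: "c \<in> A" "\<gamma> 0 \<in> cdom c" using chart_at .
  have \<gamma>U: "\<gamma> t \<in> U" for t using U(2) by blast
  have \<gamma>\<tau>: "\<gamma> \<tau> = \<gamma> 0" using curve_period[of 0 1] by simp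
  have "\<exists>\<alpha>. adjoint_solution_on {0..\<tau>} \<alpha> \<and> \<alpha> c 0 = w" for w
  proof -
    obtain \<alpha> where "adjoint_solution_on {0..\<tau>} \<alpha>" and \<alpha>0:
      "\<And>c'. c' \<in> A \<Longrightarrow> \<gamma> 0 \<in> cdom c' \<Longrightarrow> \<alpha> c' 0 = adjoint (dtransition c' c (\<gamma> 0)) w"
      by (rule adjoint_solution_exists[OF less_imp_le[OF period_pos] covector_of_coordinates[OF c, of w]])
        (rule that)
    moreover have "\<alpha> c 0 = w" unfolding \<alpha>0[OF c] by (rule adjoint_dtransition_self[OF c])
    ultimately show ?thesis by blast
  qed
  then obtain \<alpha> where \<alpha>: "\<And>w. adjoint_solution_on {0..\<tau>} (\<alpha> w)" "\<And>w. \<alpha> w c 0 = w" by metis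
  define \<beta> where "\<beta> = (\<lambda>v c t. \<Sum>b\<in>Basis. (v \<bullet> b) *\<^sub>R \<alpha> b c t)"
  have \<beta>: "adjoint_solution_on {0..\<tau>} (\<beta> v)" for v
    unfolding \<beta>_def by (rule adjoint_solution_on_sum[OF finite_Basis \<alpha>(1)])
  have \<beta>0: "\<beta> v c 0 = v" for v
    unfolding \<beta>_def by (simp add: \<alpha>(2) euclidean_representation)
  define L where "L = (\<lambda>v. \<beta> v c \<tau> - \<beta> v c 0)"
  have linL: "linear L"
    unfolding L_def \<beta>_def
    by (rule linearI)
      (simp_all add: inner_add_left scaleR_add_left sum.distrib scaleR_sum_right scaleR_diff_right)
  have orth: "L v \<bullet> F c (\<gamma> 0) = 0"
    if F: "vector_field_on A U F" "Ck_field_on A 1 U F"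
      and commF: "\<And>c p. c \<in> A \<Longrightarrow> p \<in> cdom c \<inter> U \<Longrightarrow> lie_bracket X F c p = 0" for F v
  proof -
    have ends: "0 \<in> {0..\<tau>}" "\<tau> \<in> {0..\<tau>}" using period_pos by simp_all
    have "\<beta> v c \<tau> \<bullet> F c (\<gamma> \<tau>) = pairing (\<beta> v) F \<tau>"
      by (rule pairing_eq[OF \<beta> ends(2) F(1) \<gamma>U c(1), symmetric]) (simp add: \<gamma>\<tau> c)
    also have "\<dots> = pairing (\<beta> v) F 0"
      by (rule pairing_constant[OF \<beta> U(1) \<gamma>U F commF ends(2,1)])
    also have "\<dots> = \<beta> v c 0 \<bullet> F c (\<gamma> 0)"
      by (rule pairing_eq[OF \<beta> ends(1) F(1) \<gamma>U c])
    finally show ?thesis by (simp add: L_def \<gamma>\<tau> inner_diff_left)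
  qed
  have X: "vector_field_on A U X" "Ck_field_on A 1 U X"
    using vector_field_on_subset[OF vector_field] Ck_field_on_subset[OF C1] by simp_all
  define J where "J = (\<lambda>v. integral {0..\<tau>} (pairing (\<beta> v) Y))"
  have cont: "continuous_on {0..\<tau>} (pairing (\<alpha> b) Y)" for b
    by (rule continuous_on_pairing[OF \<alpha>(1) U(1) \<gamma>U Y])
  have "J v = (\<Sum>b\<in>Basis. (v \<bullet> b) * integral {0..\<tau>} (pairing (\<alpha> b) Y))" for v
  proof -
    have "pairing (\<beta> v) Y = (\<lambda>t. \<Sum>b\<in>Basis. (v \<bullet> b) * pairing (\<alpha> b) Y t)"
      by (simp add: pairing_def \<beta>_def Let_def inner_sum_left fun_eq_iff)
    then show ?thesis
      unfolding J_def
      by (simp add: integral_sum integrable_continuous_real cont continuous_on_mult_left)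
  qed
  then have linJ: "linear J"
    by (intro linearI) (simp_all add: inner_add_left distrib_right sum.distrib sum_distrib_left mult.assoc)
  obtain v where v: "v \<noteq> 0" "L v = 0" "J v = 0"
  proof (rule common_kernel_vector[OF linL linJ])
    show "L v \<bullet> X c (\<gamma> 0) = 0" for v by (rule orth[OF X]) (simp add: lie_bracket_def)
    show "L v \<bullet> Z c (\<gamma> 0) = 0" for v by (rule orth[OF Z comm])
    show "a = 0 \<and> b = 0" if "a *\<^sub>R X c (\<gamma> 0) + b *\<^sub>R Z c (\<gamma> 0) = 0" for a b
      by (rule indep[OF c(1) _ that]) (use c \<gamma>U in simp)
  qed (rule that)
  have closes: "\<beta> v c' \<tau> = \<beta> v c' 0" if c': "c' \<in> A" "\<gamma> 0 \<in> cdom c'" for c'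
  proof -
    have "\<beta> v c' t = adjoint (dtransition c' c (\<gamma> 0)) (\<beta> v c t)" if "t = 0 \<or> t = \<tau>" for t
      using covectorD[OF adjoint_solution_covector[OF \<beta>] c'(1) c(1), of t] that c' c \<gamma>\<tau> period_pos by auto
    then show ?thesis using v(2) by (simp add: L_def)
  qed
  obtain \<omega> where \<omega>: "adjoint_solution_on UNIV (\<lambda>c t. \<omega> c (\<gamma> t))"
    "\<And>c t. c \<in> A \<Longrightarrow> \<gamma> t \<in> cdom c \<Longrightarrow> t \<in> {0..\<tau>} \<Longrightarrow> \<omega> c (\<gamma> t) = \<beta> v c t"
    by (rule periodic_adjoint_solution[OF \<beta> closes]) (assumption, assumption, rule that)
  show ?thesis
  proof (rule that)
    show "satisfies_AVE A X \<gamma> \<omega>"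
    proof (rule satisfies_AVE[OF \<omega>(1)])
      show "X c (\<gamma> t) \<noteq> 0" if "c \<in> A" "\<gamma> t \<in> cdom c" for c t
        using indep[of c "\<gamma> t" 1 0] that \<gamma>U by auto
    qed
    show "c \<in> A" "\<gamma> 0 \<in> cdom c" by (fact c)+
    show "\<omega> c (\<gamma> 0) \<noteq> 0" using \<omega>(2)[OF c] \<beta>0 v(1) period_pos by simp
    have "continuous_on {0..\<tau>} (pairing (\<beta> v) Y)"
      by (rule continuous_on_pairing[OF \<beta> U(1) \<gamma>U Y])
    then have "(pairing (\<beta> v) Y has_integral 0) {0..\<tau>}"
      using v(3) integrable_integral[OF integrable_continuous_real] unfolding J_def by fastforce
    then show "((\<lambda>t. form_apply A \<omega> Y (\<gamma> t)) has_integral 0) {0..\<tau>}"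
    proof (rule has_integral_eq[rotated])
      fix t assume t: "t \<in> {0..\<tau>}"
      obtain c' where c': "c' \<in> A" "\<gamma> t \<in> cdom c'" using chart_at .
      have "form_apply A \<omega> Y (\<gamma> t) = pairing (\<lambda>c t. \<omega> c (\<gamma> t)) Y t"
        by (simp add: form_apply_def pairing_def)
      also have "\<dots> = pairing (\<beta> v) Y t"
        using pairing_eq[OF \<omega>(1) UNIV_I Y(1) \<gamma>U c'] pairing_eq[OF \<beta> t Y(1) \<gamma>U c'] \<omega>(2)[OF c' t] by simp
      finally show "pairing (\<beta> v) Y t = form_apply A \<omega> Y (\<gamma> t)" ..
    qed
  qed
qed

end

section \<open>Regularity of the coefficients of the family\<close>

lemma at_0_within_Ico_neq_bot: "e > 0 \<Longrightarrow> at (0::real) within {0..<e} \<noteq> bot"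
proof -
  assume "e > 0"
  moreover have "{0..<e} - {0} = {0<..<e}" by auto
  ultimately show ?thesis by (simp add: at_within_eq_bot_iff)
qed

text \<open>
  The remainder is only estimated for \<open>\<epsilon> > 0\<close>; continuity of \<open>f\<close> at the end point identifies the constant
  term, and then the quadratic bound says that the linear coefficient is the one-sided derivative.
\<close>
lemma first_order_expansion:
  fixes f :: "real \<Rightarrow> 'a::real_normed_vector"
  assumes e: "e > 0" and cont: "(f \<longlongrightarrow> f 0) (at 0 within {0..<e})"
    and O: "(\<lambda>\<epsilon>. norm (f \<epsilon> - a - \<epsilon> *\<^sub>R b)) \<in> O[at 0 within {0..<e}](\<lambda>\<epsilon>. \<epsilon>\<^sup>2)"
  shows "f 0 = a" "(f has_vector_derivative b) (at 0 within {0..<e})"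
proof -
  let ?F = "at 0 within {0..<e}"
  from landau_o.bigE[OF O] obtain C where C:
    "\<forall>\<^sub>F \<epsilon> in ?F. norm (f \<epsilon> - a - \<epsilon> *\<^sub>R b) \<le> C * \<epsilon>\<^sup>2"
    by auto
  have lim0: "((\<lambda>\<epsilon>. \<epsilon>) \<longlongrightarrow> 0) ?F" by (rule tendsto_ident_at)
  have nontriv: "?F \<noteq> bot"
    by (rule at_0_within_Ico_neq_bot[OF e])
  have "((\<lambda>\<epsilon>. C * \<epsilon>\<^sup>2) \<longlongrightarrow> C * 0\<^sup>2) ?F" by (intro tendsto_intros lim0)
  then have "((\<lambda>\<epsilon>. f \<epsilon> - a - \<epsilon> *\<^sub>R b) \<longlongrightarrow> 0) ?F"
    by (intro Lim_null_comparison[OF C]) simp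
  moreover have "((\<lambda>\<epsilon>. f \<epsilon> - a - \<epsilon> *\<^sub>R b) \<longlongrightarrow> f 0 - a - 0 *\<^sub>R b) ?F"
    by (intro tendsto_intros cont)
  ultimately have "f 0 - a - 0 *\<^sub>R b = 0" by (rule tendsto_unique[OF nontriv, rotated])
  then show f0: "f 0 = a" by simp
  have "\<forall>\<^sub>F \<epsilon> in ?F. norm ((1 / norm (\<epsilon> - 0)) *\<^sub>R (f \<epsilon> - (f 0 + (\<epsilon> - 0) *\<^sub>R b))) \<le> C * \<bar>\<epsilon>\<bar>"
    using C eventually_neq_at_within[of 0]
  proof eventually_elim
    case (elim \<epsilon>)
    have "norm ((1 / norm (\<epsilon> - 0)) *\<^sub>R (f \<epsilon> - (f 0 + (\<epsilon> - 0) *\<^sub>R b))) = norm (f \<epsilon> - a - \<epsilon> *\<^sub>R b) / \<bar>\<epsilon>\<bar>"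
      by (simp add: f0 diff_diff_eq)
    also have "\<dots> \<le> C * \<epsilon>\<^sup>2 / \<bar>\<epsilon>\<bar>" using elim by (simp add: divide_right_mono)
    also have "\<epsilon>\<^sup>2 = \<bar>\<epsilon>\<bar> * \<bar>\<epsilon>\<bar>" by (simp add: power2_eq_square)
    also have "C * (\<bar>\<epsilon>\<bar> * \<bar>\<epsilon>\<bar>) / \<bar>\<epsilon>\<bar> = C * \<bar>\<epsilon>\<bar>"
      using elim by (simp del: abs_mult_self_eq)
    finally show ?case .
  qed
  moreover have "((\<lambda>\<epsilon>. C * \<bar>\<epsilon>\<bar>) \<longlongrightarrow> 0) ?F"
    using tendsto_mult_right_zero[OF tendsto_rabs_zero[OF lim0]] .
  ultimately have "((\<lambda>\<epsilon>. (1 / norm (\<epsilon> - 0)) *\<^sub>R (f \<epsilon> - (f 0 + (\<epsilon> - 0) *\<^sub>R b))) \<longlongrightarrow> 0) ?F"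
    by (rule Lim_null_comparison)
  then show "(f has_vector_derivative b) ?F"
    unfolding has_vector_derivative_def has_derivative_within by (simp add: bounded_linear_scaleR_left)
qed

text \<open>
  The expansion is pointwise in \<open>x\<close> and says nothing about the dependence of the coefficients on \<open>x\<close>.
  They inherit regularity by uniqueness: \<open>f0\<close> is the member of the family at \<open>\<epsilon> = 0\<close>, and \<open>f1\<close>
  is the restriction of the partial derivative in \<open>\<epsilon>\<close> to \<open>\<epsilon> = 0\<close>.
\<close>
lemma Ck_family_coefficients:
  fixes f :: "real \<Rightarrow> 'a::euclidean_space \<Rightarrow> 'b::real_normed_vector"
  assumes e: "e > 0" and V: "open V"
    and Ck: "Ck (Suc (Suc k)) (\<lambda>(\<epsilon>, x). f \<epsilon> x) ({0..<e} \<times> V)"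
    and O: "\<And>x. x \<in> V \<Longrightarrow> (\<lambda>\<epsilon>. norm (f \<epsilon> x - f0 x - \<epsilon> *\<^sub>R f1 x)) \<in> O[at 0 within {0..<e}](\<lambda>\<epsilon>. \<epsilon>\<^sup>2)"
  shows "Ck 1 f0 V" "Ck 1 f1 V"
proof -
  obtain f' where f': "\<And>z. z \<in> {0..<e} \<times> V \<Longrightarrow>
      ((\<lambda>(\<epsilon>, x). f \<epsilon> x) has_derivative f' z) (at z within {0..<e} \<times> V)"
    "\<And>v. Ck (Suc k) (\<lambda>z. f' z v) ({0..<e} \<times> V)"
    using Ck by (rule Ck_SucE) (rule that)
  have D: "((\<lambda>\<epsilon>. f \<epsilon> x) has_vector_derivative f' (0, x) (1, 0)) (at 0 within {0..<e})" if x: "x \<in> V" for x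
  proof -
    have d: "((\<lambda>\<epsilon>. (\<epsilon>, x)) has_derivative (\<lambda>h. (h, 0))) (at 0 within {0..<e})"
      by (auto intro!: derivative_eq_intros)
    have sub: "(\<lambda>\<epsilon>. (\<epsilon>, x)) ` {0..<e} \<subseteq> {0..<e} \<times> V" using x by auto
    have z: "(0, x) \<in> {0..<e} \<times> V" "0 \<in> {0..<e}" using e x by auto
    have eq: "h *\<^sub>R f' (0, x) (1, 0) = f' (0, x) (h, 0)" for h
      using linear_scale[OF has_derivative_linear[OF f'(1)[OF z(1)]], of h "(1, 0)"] by simp
    show ?thesis
      unfolding has_vector_derivative_def eq using has_derivative_in_compose2[OF f'(1) sub z(2) d] by simp
  qed
  have cont: "((\<lambda>\<epsilon>. f \<epsilon> x) \<longlongrightarrow> f 0 x) (at 0 within {0..<e})" if "x \<in> V" for x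
    using has_vector_derivative_continuous[OF D[OF that]] by (simp add: continuous_within)
  note expand = first_order_expansion[OF e cont O]
  have f0: "f 0 x = f0 x" if "x \<in> V" for x by (rule expand(1)[OF that that])
  show "Ck 1 f0 V" by (rule Ck_cong[rotated, OF Ck_slice[OF e V Ck]]) (rule f0)
  have f1: "f' (0, x) (1, 0) = f1 x" if "x \<in> V" for x
    by (rule vector_derivative_unique_within[OF at_0_within_Ico_neq_bot[OF e] D[OF that] expand(2)[OF that that]])
  have "(\<lambda>z. f' z (1, 0)) = (\<lambda>(\<epsilon>, x). f' (\<epsilon>, x) (1, 0))" by auto
  with f'(2)[of "(1, 0)"] have "Ck (Suc k) (\<lambda>(\<epsilon>, x). f' (\<epsilon>, x) (1, 0)) ({0..<e} \<times> V)" by metis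
  from Ck_slice[OF e V this] show "Ck 1 f1 V" by (rule Ck_cong[rotated]) (rule f1)
qed

section \<open>The obstruction integral\<close>

theorem theorem3p8:
  fixes A :: "('m::t2_space, 'n::finite) chart set"
    and X :: "real \<Rightarrow> ('m, 'n) field"
    and X0 X1 Z :: "('m, 'n) field"
    and e T :: real
    and \<gamma> :: "real \<Rightarrow> 'm"
    and U :: "'m set"
    and T' :: "real \<Rightarrow> real"
    and \<gamma>' :: "real \<Rightarrow> real \<Rightarrow> 'm"
  assumes "CARD('n) \<ge> 2"
    and "paracompact_space (euclidean :: 'm topology)"
    and "oriented_manifold 4 A"
    and "e > 0"
    and "Ck_vector_field_family A 3 e X"
    and "vector_field_on A UNIV X0"
    and "vector_field_on A UNIV X1"
    and "\<forall>c\<in>A. \<forall>p\<in>cdom c.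
           (\<lambda>\<epsilon>. norm (X \<epsilon> c p - X0 c p - \<epsilon> *\<^sub>R X1 c p)) \<in> O[at 0 within {0..<e}](\<lambda>\<epsilon>. \<epsilon>\<^sup>2)"
    and "periodic_orbit A X0 T \<gamma>"
    and "open U"
    and "\<gamma> ` {0..<T} \<subseteq> U"
    and "vector_field_on A U Z"
    and "Ck_field_on A 3 U Z"
    and "\<forall>c\<in>A. \<forall>p\<in>cdom c \<inter> U. lie_bracket X0 Z c p = 0"
    and "\<forall>c\<in>A. \<forall>p\<in>cdom c \<inter> U. \<forall>a b. a *\<^sub>R X0 c p + b *\<^sub>R Z c p = 0 \<longrightarrow> a = 0 \<and> b = 0"
    and "\<forall>\<epsilon>\<in>{0..<e}. periodic_orbit A (X \<epsilon>) (T' \<epsilon>) (\<gamma>' \<epsilon>)"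
    and "Ck 2 T' {0..<e}"
    and "\<forall>t. Ck_into A 2 (\<lambda>\<epsilon>. \<gamma>' \<epsilon> t) {0..<e}"
    and "T' 0 = T"
    and "\<gamma>' 0 = \<gamma>"
  shows "\<exists>\<omega>. satisfies_AVE A X0 \<gamma> \<omega> \<and>
           (\<exists>c\<in>A. \<exists>p\<in>cdom c \<inter> \<gamma> ` {0..<T}. \<omega> c p \<noteq> 0) \<and>
           ((\<lambda>t. form_apply A \<omega> (lie_bracket X1 Z) (\<gamma> t)) has_integral 0) {0..T}"
proof -
  note manifold = assms(3) and e = assms(4) and orbit = assms(9) and U = assms(10,11)
    and Z = assms(12,13) and comm = assms(14) and indep = assms(15)
  interpret C2_atlas A 4 by unfold_locales (use manifold in simp_all)
  have T: "T > 0" and sol: "solution A X0 \<gamma>" and per: "\<And>t. \<gamma> (t + T) = \<gamma> t"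
    using orbit unfolding periodic_orbit_def by blast+
  have "Ck 1 (local_rep X0 c) (cmap c ` cdom c) \<and> Ck 1 (local_rep X1 c) (cmap c ` cdom c)" if c: "c \<in> A" for c
  proof -
    have fam: "Ck (Suc (Suc 1)) (\<lambda>(\<epsilon>, x). local_rep (X \<epsilon>) c x) ({0..<e} \<times> cmap c ` cdom c)"
      using assms(5) c unfolding Ck_vector_field_family_def by (simp add: eval_nat_numeral)
    have expansion: "(\<lambda>\<epsilon>. norm (local_rep (X \<epsilon>) c x - local_rep X0 c x - \<epsilon> *\<^sub>R local_rep X1 c x))
        \<in> O[at 0 within {0..<e}](\<lambda>\<epsilon>. \<epsilon>\<^sup>2)" if "x \<in> cmap c ` cdom c" for x
    proof -
      have "cinv c x \<in> cdom c" using that cinv_cmap[OF c] by auto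
      then show ?thesis unfolding local_rep_def by (rule assms(8)[rule_format, OF c])
    qed
    show ?thesis
      by (rule conjI; rule Ck_family_coefficients[OF e open_cmap_cdom[OF c] fam expansion])
  qed
  then have coeff: "Ck_field_on A 1 UNIV X0" "Ck_field_on A 1 UNIV X1"
    unfolding Ck_field_on_def by simp_all
  interpret solution_curve A 4 X0 \<gamma>
    by unfold_locales (fact assms(6) coeff(1) sol)+
  obtain c where c: "c \<in> A" "\<gamma> 0 \<in> cdom c" using chart_at .
  have \<gamma>0: "\<gamma> 0 \<in> U" using U(2) T by force
  have "X0 c (\<gamma> 0) \<noteq> 0"
    using indep[rule_format, OF c(1), of "\<gamma> 0" 1 0] c \<gamma>0 by auto
  moreover have "\<gamma> T = \<gamma> 0" using per[of 0] by simp
  ultimately obtain \<tau> where \<tau>: "\<tau> > 0" "\<And>s t. \<gamma> s = \<gamma> t \<longleftrightarrow> (\<exists>n::int. s - t = of_int n * \<tau>)"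
    using minimal_period[OF T _ c] by metis
  \<comment> \<open>A section is a function on the orbit, so it has to be built over the minimal period, not over \<open>T\<close>.\<close>
  interpret closed_orbit A 4 X0 \<gamma> \<tau>
    by unfold_locales (fact \<tau>)+
  obtain m :: int where m: "T = of_int m * \<tau>" using \<open>\<gamma> T = \<gamma> 0\<close> \<tau>(2)[of T 0] by auto
  have "m > 0" using T \<tau>(1) unfolding m by (simp add: zero_less_mult_iff)
  define n where "n = nat m"
  have n: "T = of_nat n * \<tau>" using \<open>m > 0\<close> by (simp add: n_def m)
  have "1 * \<tau> \<le> of_int m * \<tau>" using \<open>m > 0\<close> \<tau>(1) by (intro mult_right_mono) auto
  then have \<tau>T: "\<tau> \<le> T" by (simp add: m)
  have \<gamma>U: "range \<gamma> \<subseteq> U"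
  proof
    fix p assume "p \<in> range \<gamma>"
    then obtain t where t: "p = \<gamma> t" by blast
    obtain k :: int where "0 \<le> t - of_int k * \<tau>" "t - of_int k * \<tau> < 0 + \<tau>" by (rule period_interval)
    moreover have "\<gamma> (t - of_int k * \<tau>) = p" using curve_period[of "t - of_int k * \<tau>" k] t by simp
    ultimately show "p \<in> U" using U(2) \<tau>T by force
  qed
  have ZC1: "Ck_field_on A 1 U Z"
    by (rule Ck_field_on_mono[OF Z(2)]) simp
  note X1 = vector_field_on_subset[OF assms(7) subset_UNIV] Ck_field_on_subset[OF coeff(2) subset_UNIV]
  have Y: "vector_field_on A U (lie_bracket X1 Z)"
    unfolding vector_field_on_def
    using lie_bracket_transition[OF _ _ _ U(1) _ X1 Z(1) ZC1] by blast
  obtain \<omega> c where \<omega>: "satisfies_AVE A X0 \<gamma> \<omega>" "c \<in> A" "\<gamma> 0 \<in> cdom c" "\<omega> c (\<gamma> 0) \<noteq> 0"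
    "((\<lambda>t. form_apply A \<omega> (lie_bracket X1 Z) (\<gamma> t)) has_integral 0) {0..\<tau>}"
  proof (rule AVE_section_in_kernel[OF U(1) \<gamma>U Z(1) ZC1 _ _ Y])
    show "lie_bracket X0 Z c p = 0" if "c \<in> A" "p \<in> cdom c \<inter> U" for c p
      using comm that by blast
    show "a = 0 \<and> b = 0" if "c \<in> A" "p \<in> cdom c \<inter> U" "a *\<^sub>R X0 c p + b *\<^sub>R Z c p = 0" for c p a b
      using indep that by blast
    show "continuous_on (cdom c \<inter> U) (lie_bracket X1 Z c)" if "c \<in> A" for c
      by (rule continuous_on_lie_bracket[OF that U(1) X1(2) ZC1])
  qed (rule that)
  have "((\<lambda>t. form_apply A \<omega> (lie_bracket X1 Z) (\<gamma> t)) has_integral of_nat n *\<^sub>R 0) {0..of_nat n * \<tau>}"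
  proof (rule has_integral_periods[OF \<tau>(1) _ \<omega>(5)])
    show "form_apply A \<omega> (lie_bracket X1 Z) (\<gamma> (t + of_nat k * \<tau>)) = form_apply A \<omega> (lie_bracket X1 Z) (\<gamma> t)"
      for t k using curve_period[of t "int k"] by simp
  qed
  then have "((\<lambda>t. form_apply A \<omega> (lie_bracket X1 Z) (\<gamma> t)) has_integral 0) {0..T}"
    by (simp add: n)
  moreover have "\<gamma> 0 \<in> cdom c \<inter> \<gamma> ` {0..<T}" using \<omega>(3) T by auto
  ultimately show ?thesis using \<omega>(1,2,4) by blast
qed

end
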